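(* Let $G$ be a finite simple undirected graph on $n$ vertices and let $k$ be an integer with $2 \leq k \leq n$ such that $G$ is $k$-cyclable. Then (i) if $k \leq \sqrt{n+3}$, then $c(G) \geq 2k$; (ii) if $k \leq \frac{3n}{4} - 1$, then $c(G) \geq k+2$. Moreover, for $2 \leq k \leq \sqrt{n+3}$ the bound in (i) is best possible: there exists a $k$-cyclable graph on $n$ vertices whose circumference is exactly $2k$.
   Context: A subset $S \subseteq V(G)$ is cyclable if some cycle of $G$ contains all vertices of $S$ (in some order, possibly together with other vertices). $G$ is $k$-cyclable ($k \geq 2$) if every set of $k$ vertices of $G$ is cyclable. The circumference $c(G)$ is the length of a longest cycle in $G$.
   Formalization: Part (i) excludes n = 3, where K_3 is 2-cyclable with circumference 3 < 4, and the sharpness claim assumes n ≥ 4, since a graph on 2 or 3 vertices cannot have circumference 2k = 4; in these cases the statement as written is false. *)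

theory Defs
  imports Complex_Main
begin

definition fin_simple_graph :: "'a set \<Rightarrow> 'a set set \<Rightarrow> bool" where
  "fin_simple_graph V E \<longleftrightarrow> finite V \<and> (\<forall>e\<in>E. e \<subseteq> V \<and> card e = 2)"

text \<open>A cycle is given by the list of its vertices in cyclic order, each listed once; hence its
  length as a cycle is the length of the list, which is at least 3.\<close>

definition is_cycle :: "'a set \<Rightarrow> 'a set set \<Rightarrow> 'a list \<Rightarrow> bool" where
  "is_cycle V E c \<longleftrightarrow>
     3 \<le> length c \<and> distinct c \<and> set c \<subseteq> V \<and>
     (\<forall>i<length c. {c ! i, c ! (Suc i mod length c)} \<in> E)"

definition cyclable :: "'a set \<Rightarrow> 'a set set \<Rightarrow> 'a set \<Rightarrow> bool" where
  "cyclable V E S \<longleftrightarrow> S \<subseteq> V \<and> (\<exists>c. is_cycle V E c \<and> S \<subseteq> set c)"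

definition k_cyclable :: "nat \<Rightarrow> 'a set \<Rightarrow> 'a set set \<Rightarrow> bool" where
  "k_cyclable k V E \<longleftrightarrow> (\<forall>S. S \<subseteq> V \<and> card S = k \<longrightarrow> cyclable V E S)"

text \<open>The element 0 only serves to give acyclic graphs the circumference 0.\<close>

definition circumference :: "'a set \<Rightarrow> 'a set set \<Rightarrow> nat" where
  "circumference V E = Max (insert 0 {length c | c. is_cycle V E c})"

end

theory Submission
  imports Defs
begin

text \<open>
  Let \<open>c\<close> be a longest cycle, \<open>H\<close> a component of the graph minus \<open>c\<close> and \<open>N\<close> the set of the \<open>m\<close>
  vertices of \<open>c\<close> attached to \<open>H\<close>. A vertex of \<open>H\<close> and the \<open>m\<close> successors of \<open>N\<close> on \<open>c\<close> lie in
  different components once the other vertices of \<open>c\<close> are deleted, so every cycle through these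
  \<open>m + 1\<close> vertices uses at least \<open>m + 1\<close> of the deleted ones.

  (ii) If all cycles have length at most \<open>k + 1\<close>, then \<open>m \<ge> n - k + 1\<close>: otherwise a \<open>k\<close>-set avoiding
  \<open>N\<close> and meeting both sides of the cut \<open>N\<close> gives a cycle of length \<open>k + 2\<close>. A cycle through all
  vertices off \<open>c\<close> and the successors of \<open>N\<close> then has length at least
  \<open>n - |c| + 2 m + 1 \<ge> 3 n - 3 k + 2 > k + 1\<close>.

  (i) If \<open>|c| < 2 k\<close>, then no \<open>k\<close> vertices are independent, and \<open>m \<le> k - 2\<close>. The case
  \<open>k = 2\<close> is covered by (ii). For \<open>k = 3\<close> this
  contradicts 2-connectedness. For \<open>k \<ge> 4\<close> put \<open>d = k - 2\<close>; counting shows that the set \<open>R\<close> of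
  vertices off \<open>c\<close> has more than \<open>d\<close> times as many vertices as its independence number. A minimal
  subset \<open>K\<close> of \<open>R\<close> with this property is 2-connected with minimum degree at least \<open>d\<close>, so any two of
  its vertices are joined inside \<open>K\<close> by a path on \<open>d + 1\<close> vertices (Erdos and Gallai). A cycle through
  two vertices of \<open>K\<close> and two of \<open>c\<close> links \<open>K\<close> to \<open>c\<close> by two disjoint paths. The resulting ear has at
  least \<open>k - 1\<close> inner vertices, and maximality of \<open>c\<close> gives \<open>|c| \<ge> 2 k\<close>.
\<close>

section \<open>Finite simple graphs, paths and cycles as lists\<close>

locale sgraph =
  fixes V :: "'a set" and E :: "'a set set"
  assumes fin_simple: "fin_simple_graph V E"
begin

definition adj :: "'a \<Rightarrow> 'a \<Rightarrow> bool" where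
  "adj u v \<longleftrightarrow> {u, v} \<in> E"

definition path_in :: "'a set \<Rightarrow> 'a list \<Rightarrow> bool" where
  "path_in U p \<longleftrightarrow> p \<noteq> [] \<and> distinct p \<and> set p \<subseteq> U \<and> successively adj p"

text \<open>The closing edge is kept apart from the list of vertices, so that cycles can be cut and
  rearranged by the lemmas on appended lists.\<close>

definition cyc :: "'a list \<Rightarrow> bool" where
  "cyc c \<longleftrightarrow> 3 \<le> length c \<and> path_in V c \<and> adj (last c) (hd c)"

text \<open>The closure is reflexive outside \<open>U\<close> as well, so membership of an endpoint
  in \<open>U\<close> has to be carried separately.\<close>

definition reach :: "'a set \<Rightarrow> ('a \<times> 'a) set" where
  "reach U = {(u, v). u \<in> U \<and> v \<in> U \<and> adj u v}\<^sup>*"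

definition conn :: "'a set \<Rightarrow> bool" where
  "conn U \<longleftrightarrow> (\<forall>u\<in>U. \<forall>v\<in>U. (u, v) \<in> reach U)"

text \<open>2-connectedness without a lower bound on the size: single vertices and edges qualify, so
  blocks that are single edges need no separate treatment in \<open>nocut_path\<close>.\<close>

definition nocut :: "'a set \<Rightarrow> bool" where
  "nocut U \<longleftrightarrow> conn U \<and> (\<forall>z. conn (U - {z}))"

definition nbrs :: "'a set \<Rightarrow> 'a \<Rightarrow> 'a set" where
  "nbrs U v = {u \<in> U. adj v u}"

definition indep :: "'a set \<Rightarrow> bool" where
  "indep J \<longleftrightarrow> (\<forall>u\<in>J. \<forall>v\<in>J. \<not> adj u v)"

lemma finite_V: "finite V"
  using fin_simple by (simp add: fin_simple_graph_def)

lemma adj_sym: "adj u v \<Longrightarrow> adj v u"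
  by (simp add: adj_def insert_commute)

lemma adj_irrefl: "\<not> adj u u"
  using fin_simple by (force simp: adj_def fin_simple_graph_def)

lemma adj_V: "adj u v \<Longrightarrow> u \<in> V \<and> v \<in> V"
  using fin_simple by (auto simp: adj_def fin_simple_graph_def)

lemma successively_rev_adj: "successively adj (rev p) \<longleftrightarrow> successively adj p"
proof -
  have "(\<lambda>x y. adj y x) = adj" using adj_sym by blast
  then show ?thesis by (metis successively_rev)
qed

lemma is_cycle_iff_cyc: "is_cycle V E c \<longleftrightarrow> cyc c"
proof (cases "3 \<le> length c")
  case True
  then have ne: "c \<noteq> []" by auto
  have "(\<forall>i<length c. adj (c ! i) (c ! (Suc i mod length c))) \<longleftrightarrow>
      (\<forall>i. Suc i < length c \<longrightarrow> adj (c ! i) (c ! Suc i)) \<and> adj (c ! (length c - 1)) (c ! 0)"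
    (is "?L \<longleftrightarrow> ?R")
  proof
    assume L: ?L
    have "adj (c ! i) (c ! Suc i)" if "Suc i < length c" for i
      using L[rule_format, of i] that by simp
    moreover have "adj (c ! (length c - 1)) (c ! 0)"
      using L[rule_format, of "length c - 1"] True ne by simp
    ultimately show ?R by blast
  next
    assume R: ?R
    show ?L
    proof (intro allI impI)
      fix i assume i: "i < length c"
      show "adj (c ! i) (c ! (Suc i mod length c))"
      proof (cases "Suc i = length c")
        case True
        then have "i = length c - 1" by simp
        then show ?thesis using R True by simp
      next
        case False
        then show ?thesis using R i by simp
      qed
    qed
  qed
  then show ?thesis
    using ne by (auto simp: is_cycle_def cyc_def path_in_def adj_def[symmetric] successively_conv_nth
        last_conv_nth hd_conv_nth)
next
  case False
  then show ?thesis by (simp add: is_cycle_def cyc_def)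
qed

lemma cyc_rotate: "cyc (p @ q) \<Longrightarrow> cyc (q @ p)"
  by (cases "p = []"; cases "q = []")
    (auto simp: cyc_def path_in_def successively_append_iff)

lemma cyc_from:
  assumes "cyc c" "a \<in> set c"
  obtains xs where "cyc (a # xs)" "set (a # xs) = set c" "length (a # xs) = length c"
proof -
  obtain p q where c: "c = p @ a # q" using assms(2) by (meson split_list)
  show ?thesis
  proof (rule that[of "q @ p"])
    show "cyc (a # q @ p)" using cyc_rotate[of p "a # q"] assms(1) c by simp
  qed (use c in auto)
qed

lemma cyc_simps:
  assumes "cyc c"
  shows "c \<noteq> []" "distinct c" "set c \<subseteq> V" "successively adj c" "adj (last c) (hd c)" "3 \<le> length c"
    "card (set c) = length c"
  using assms by (auto simp: cyc_def path_in_def distinct_card)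

subsection \<open>Separated vertices on a cycle\<close>

text \<open>\<open>f\<close> stands for a labelling of the components left after deleting
  \<open>T\<close>.\<close>

lemma label_const:
  assumes "successively adj zs" and "set zs \<inter> T = {}"
    and f: "\<And>u v. u \<notin> T \<Longrightarrow> v \<notin> T \<Longrightarrow> adj u v \<Longrightarrow> f u = f v"
    and "x \<in> set zs"
  shows "f x = f (hd zs)"
  using assms(1,2,4)
proof (induction zs arbitrary: x)
  case Nil
  then show ?case by simp
next
  case (Cons a zs)
  show ?case
  proof (cases "x = a \<or> zs = []")
    case False
    have "f x = f (hd zs)"
      by (rule Cons.IH) (use Cons.prems False in \<open>auto simp: successively_Cons\<close>)
    moreover have "f a = f (hd zs)"
      using f[of a "hd zs"] Cons.prems False hd_in_set[of zs]
      by (auto simp: successively_Cons simp del: hd_in_set)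
    ultimately show ?thesis by simp
  qed (use Cons.prems in auto)
qed

text \<open>Distinct vertices of \<open>P\<close> have different labels, so a vertex of
  \<open>T\<close> lies between them on the path. The induction cuts at the last vertex of
  \<open>T\<close>, behind which at most one vertex of \<open>P\<close> remains; the sharper bound
  for paths ending in \<open>T\<close> leaves room for it.\<close>

lemma card_separated_path:
  assumes f: "\<And>u v. u \<notin> T \<Longrightarrow> v \<notin> T \<Longrightarrow> adj u v \<Longrightarrow> f u = f v"
    and inj: "inj_on f P" and disj: "P \<inter> T = {}"
  shows "successively adj xs \<Longrightarrow> distinct xs \<Longrightarrow> card (P \<inter> set xs) \<le> card (T \<inter> set xs) + 1
     \<and> (xs \<noteq> [] \<longrightarrow> last xs \<in> T \<longrightarrow> card (P \<inter> set xs) \<le> card (T \<inter> set xs))"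
proof (induction "length xs" arbitrary: xs rule: less_induct)
  case less
  show ?case
  proof (cases "set xs \<inter> T = {}")
    case True
    have "is_singleton (P \<inter> set xs) \<or> P \<inter> set xs = {}"
    proof -
      have "x = y" if "x \<in> P \<inter> set xs" "y \<in> P \<inter> set xs" for x y
        using that label_const[where f=f and T=T, OF less.prems(1) True f, where x=x]
            label_const[where f=f and T=T, OF less.prems(1) True f, where x=y] inj
        by (auto simp: inj_on_def)
      then show ?thesis by (metis equals0I is_singletonI')
    qed
    then have "card (P \<inter> set xs) \<le> 1" by (auto simp: is_singleton_altdef)
    then show ?thesis using True by (cases "xs = []") (auto dest: last_in_set)
  next
    case False
    then obtain ys t zs where xs: "xs = ys @ t # zs" "t \<in> T" "\<forall>z\<in>set zs. z \<notin> T"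
      using split_list_last_prop[of xs "\<lambda>x. x \<in> T"] by blast
    have IHy: "card (P \<inter> set ys) \<le> card (T \<inter> set ys) + 1"
      using less.hyps[of ys] less.prems xs by (simp add: successively_append_iff)
    have ft: "card (T \<inter> set xs) = card (T \<inter> set ys) + 1"
    proof -
      have "T \<inter> set xs = insert t (T \<inter> set ys)" using xs by auto
      moreover have "t \<notin> set ys" using xs less.prems by auto
      ultimately show ?thesis by simp
    qed
    show ?thesis
    proof (cases "zs = []")
      case True
      then have "P \<inter> set xs = P \<inter> set ys" using xs disj by auto
      then show ?thesis using IHy ft by simp
    next
      case False
      have "card (P \<inter> set zs) \<le> card (T \<inter> set zs) + 1"
        using less.hyps[of zs] less.prems xs by (simp add: successively_append_iff successively_Cons False)
      moreover have "T \<inter> set zs = {}" using xs by auto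
      ultimately have z: "card (P \<inter> set zs) \<le> 1" by simp
      have y: "card (P \<inter> set (ys @ [t])) \<le> card (T \<inter> set (ys @ [t]))"
        using less.hyps[of "ys @ [t]"] less.prems xs False
        by (simp add: successively_append_iff successively_Cons)
      have "P \<inter> set xs = P \<inter> set (ys @ [t]) \<union> P \<inter> set zs" using xs by auto
      then have "card (P \<inter> set xs) \<le> card (P \<inter> set (ys @ [t])) + card (P \<inter> set zs)"
        by (metis card_Un_le)
      moreover have "T \<inter> set xs = T \<inter> set (ys @ [t])" using xs by auto
      moreover have "last xs \<notin> T" using xs False by auto
      ultimately show ?thesis using y z by simp
    qed
  qed
qed

text \<open>Two labels force a vertex of \<open>T\<close> onto the cycle. Rotated to the end, it
  makes the sharper bound of \<open>card_separated_path\<close> applicable.\<close>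

lemma card_separated_cycle:
  assumes f: "\<And>u v. u \<notin> T \<Longrightarrow> v \<notin> T \<Longrightarrow> adj u v \<Longrightarrow> f u = f v"
    and inj: "inj_on f P" and disj: "P \<inter> T = {}"
    and D: "cyc D" "P \<subseteq> set D" and P: "2 \<le> card P"
  shows "card P \<le> card (T \<inter> set D)"
proof -
  have "\<exists>t\<in>T. t \<in> set D"
  proof (rule ccontr)
    assume "\<not> ?thesis"
    then have *: "set D \<inter> T = {}" by auto
    have "x = y" if "x \<in> P" "y \<in> P" for x y
    proof -
      have "x \<in> set D" "y \<in> set D" using that D(2) by auto
      then have "f x = f (hd D)" "f y = f (hd D)"
        using label_const[where f=f and T=T, OF cyc_simps(4)[OF D(1)] * f] by blast+
      then show ?thesis using that inj by (auto simp: inj_on_def)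
    qed
    then have "card P \<le> 1" by (metis card_le_Suc0_iff_eq One_nat_def finite_subset[OF D(2)] finite_set)
    then show False using P by simp
  qed
  then obtain t xs where t: "t \<in> T" and xs: "cyc (t # xs)" "set (t # xs) = set D"
    using cyc_from[OF D(1)] by metis
  have c: "cyc (xs @ [t])" using cyc_rotate[of "[t]" xs] xs by simp
  have "card (P \<inter> set (xs @ [t])) \<le> card (T \<inter> set (xs @ [t]))"
    using card_separated_path[of T f P "xs @ [t]"] f inj disj cyc_simps(2,4)[OF c] t by auto
  moreover have "set (xs @ [t]) = set D" using xs by auto
  moreover have "P \<inter> set D = P" using D by auto
  ultimately show ?thesis by simp
qed

subsection \<open>Reachability\<close>

lemma reach_sym: "(u, v) \<in> reach U \<Longrightarrow> (v, u) \<in> reach U"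
proof -
  have "sym {(u, v). u \<in> U \<and> v \<in> U \<and> adj u v}" by (auto simp: sym_def adj_sym)
  then show "(u, v) \<in> reach U \<Longrightarrow> (v, u) \<in> reach U"
    unfolding reach_def by (metis sym_rtrancl symD)
qed

lemma reach_refl: "(u, u) \<in> reach U"
  by (simp add: reach_def)

lemma reach_trans: "(u, v) \<in> reach U \<Longrightarrow> (v, w) \<in> reach U \<Longrightarrow> (u, w) \<in> reach U"
  by (simp add: reach_def)

lemma reach_step: "(u, v) \<in> reach U \<Longrightarrow> v \<in> U \<Longrightarrow> w \<in> U \<Longrightarrow> adj v w \<Longrightarrow> (u, w) \<in> reach U"
  unfolding reach_def by (rule rtrancl_into_rtrancl) auto

lemma reach_induct [consumes 1, case_names refl step]:
  assumes "(u, v) \<in> reach U" "Q u"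
    and "\<And>v w. (u, v) \<in> reach U \<Longrightarrow> Q v \<Longrightarrow> v \<in> U \<Longrightarrow> w \<in> U \<Longrightarrow> adj v w \<Longrightarrow> Q w"
  shows "Q v"
  using assms(1) unfolding reach_def
proof (induction rule: rtrancl_induct)
  case base
  then show ?case by (rule assms(2))
next
  case (step v w)
  then show ?case using assms(3)[of v w] by (auto simp: reach_def)
qed

lemma reach_in: "(u, v) \<in> reach U \<Longrightarrow> u \<in> U \<Longrightarrow> v \<in> U"
  by (induction rule: reach_induct) auto

lemma reach_crossing:
  assumes "(u, v) \<in> reach U" "u \<in> X" "v \<notin> X"
  obtains x y where "x \<in> X \<inter> U" "y \<in> U - X" "adj x y"
proof -
  have "v \<in> X \<or> (\<exists>x y. x \<in> X \<inter> U \<and> y \<in> U - X \<and> adj x y)"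
    using assms(1) by (induction rule: reach_induct) (use assms(2) in auto)
  then show ?thesis using assms(3) that by blast
qed

lemma reach_path:
  assumes "(u, v) \<in> reach U" "u \<in> U"
  obtains p where "path_in U p" "hd p = u" "last p = v"
proof -
  have "\<exists>p. path_in U p \<and> hd p = u \<and> last p = v"
    using assms(1)
  proof (induction rule: reach_induct)
    case refl
    have "path_in U [u]" using assms(2) by (simp add: path_in_def)
    then show ?case by (metis last_ConsL list.sel(1))
  next
    case (step v w)
    then obtain p where p: "path_in U p" "hd p = u" "last p = v" by blast
    show ?case
    proof (cases "w \<in> set p")
      case True
      then obtain r s where "p = r @ w # s" by (meson split_list)
      then have "path_in U (r @ [w])" "hd (r @ [w]) = u" "last (r @ [w]) = w"
        using p by (auto simp: path_in_def successively_append_iff hd_append)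
      then show ?thesis by blast
    next
      case False
      then have "path_in U (p @ [w])" "hd (p @ [w]) = u" "last (p @ [w]) = w"
        using p step by (auto simp: path_in_def successively_append_iff hd_append)
      then show ?thesis by blast
    qed
  qed
  then show ?thesis using that by blast
qed

lemma path_reach:
  assumes "successively adj p" "set p \<subseteq> U" "x \<in> set p" "y \<in> set p"
  shows "(x, y) \<in> reach U"
proof -
  have *: "(hd p, x) \<in> reach U" if "successively adj p" "set p \<subseteq> U" "x \<in> set p" for x p
    using that
  proof (induction p arbitrary: x rule: rev_induct)
    case Nil
    then show ?case by simp
  next
    case (snoc a p)
    show ?case
    proof (cases "p = []")
      case True
      then show ?thesis using snoc by (simp add: reach_refl)
    next
      case False
      have p: "(hd p, z) \<in> reach U" if "z \<in> set p" for z
        using snoc that by (auto simp: successively_append_iff)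
      show ?thesis
      proof (cases "x = a")
        case True
        have "set p \<subseteq> U" using snoc.prems by simp
        then have "last p \<in> U" using \<open>p \<noteq> []\<close> last_in_set by blast
        with True show ?thesis using reach_step[OF p[of "last p"], of a] snoc.prems \<open>p \<noteq> []\<close>
          by (auto simp: successively_append_iff hd_append)
      next
        case False
        then show ?thesis using p[of x] snoc.prems by (auto simp: hd_append)
      qed
    qed
  qed
  show ?thesis using *[OF assms(1,2,3)] *[OF assms(1,2,4)] reach_sym reach_trans by blast
qed

lemma reach_class_conn:
  assumes "(z, v) \<in> reach U" "z \<in> U"
  shows "(z, v) \<in> reach {w. (z, w) \<in> reach U}"
  using assms(1)
proof (induction rule: reach_induct)
  case refl
  then show ?case by (rule reach_refl)
next
  case (step v w)
  then have "(z, w) \<in> reach U" by (meson reach_step)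
  then show ?case using reach_step[OF step.IH, of w] step.hyps by simp
qed

lemma conn_reach_class:
  assumes "z \<in> U"
  shows "conn {w. (z, w) \<in> reach U}"
  unfolding conn_def using reach_class_conn[OF _ assms] reach_sym reach_trans by blast


lemma connD: "conn U \<Longrightarrow> u \<in> U \<Longrightarrow> v \<in> U \<Longrightarrow> (u, v) \<in> reach U"
  by (simp add: conn_def)

lemma nocutD: "nocut U \<Longrightarrow> conn U" "nocut U \<Longrightarrow> conn (U - {z})"
  by (simp_all add: nocut_def)

lemma conn_if_reach:
  assumes "\<And>u. u \<in> U \<Longrightarrow> (u, b) \<in> reach U"
  shows "conn U"
  unfolding conn_def by (metis assms reach_sym reach_trans)

lemma reach_mono:
  assumes "U \<subseteq> W" "(u, v) \<in> reach U"
  shows "(u, v) \<in> reach W"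
  using assms(2)
proof (induction rule: reach_induct)
  case refl
  show ?case by (rule reach_refl)
next
  case (step v w)
  then show ?case using reach_step[OF step.IH, of w] assms(1) by blast
qed

section \<open>Long paths in graphs without cut vertices\<close>

text \<open>Induction on \<open>d\<close>. Among the components avoiding \<open>y\<close> that
  remain after deleting \<open>x\<close> and some \<open>b\<close>, take a smallest one,
  \<open>L\<close>. Together with \<open>b\<close> it again has no cut vertex, and its vertices lose
  only the neighbour \<open>x\<close>. A long path in it is extended to \<open>x\<close> at one end
  and to \<open>y\<close> at the other. The degree bound exempts \<open>y\<close> because
  \<open>b\<close>, which takes its place in the smaller graph, may lose many neighbours.\<close>

lemma nocut_path:
  assumes "finite W" "nocut W" "x \<in> W" "y \<in> W" "x \<noteq> y"
    and "\<And>v. v \<in> W - {y} \<Longrightarrow> d \<le> card (nbrs W v)"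
  shows "\<exists>p. path_in W p \<and> hd p = x \<and> last p = y \<and> d + 1 \<le> length p"
  using assms
proof (induction d arbitrary: W x y)
  case 0
  obtain p where "path_in W p" "hd p = x" "last p = y"
    using reach_path[OF connD[OF nocutD(1)]] 0 by metis
  moreover from this have "0 + 1 \<le> length p" by (cases p) (auto simp: path_in_def)
  ultimately show ?case by blast
next
  case (Suc d)
  note fin = \<open>finite W\<close> and nc = \<open>nocut W\<close>
  show ?case
  proof (cases "d = 0")
    \<comment> \<open>The degree bound is 1 here, so \<open>x\<close> may have \<open>y\<close> as
      its only neighbour; any path between distinct vertices suffices.\<close>
    case True
    obtain p where p: "path_in W p" "hd p = x" "last p = y"
      using reach_path[OF connD[OF nocutD(1)]] Suc.prems by metis
    moreover have "2 \<le> length p"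
      using p \<open>x \<noteq> y\<close> by (cases p; cases "tl p") (auto simp: path_in_def)
    ultimately show ?thesis using True by auto
  next
    case False
    define lobe where "lobe = (\<lambda>(b, z). {w. (z, w) \<in> reach (W - {x, b})})"
    define good where "good = (\<lambda>(b, z). b \<in> W - {x} \<and> z \<in> W - {x, b} \<and> y \<notin> lobe (b, z))"
    \<comment> \<open>\<open>b = y\<close> always gives a candidate: \<open>x\<close> has degree at
      least 2 and so a neighbour other than \<open>y\<close>.\<close>
    have "\<exists>bz. good bz"
    proof -
      have "\<not> nbrs W x \<subseteq> {y}"
        using Suc.prems(6)[of x] Suc.prems False card_mono[of "{y}" "nbrs W x"] by fastforce
      then obtain z where z: "z \<in> W" "adj x z" "z \<noteq> y" unfolding nbrs_def by blast
      then have "z \<in> W - {x, y}" using adj_irrefl by auto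
      moreover from this have "y \<notin> lobe (y, z)" unfolding lobe_def using reach_in by fastforce
      ultimately have "good (y, z)" using Suc.prems by (simp add: good_def)
      then show ?thesis by blast
    qed
    then obtain bz where bz: "good bz" "\<And>bz'. good bz' \<Longrightarrow> card (lobe bz) \<le> card (lobe bz')"
      using ex_has_least_nat[where P = good and m = "\<lambda>bz. card (lobe bz)"] by blast
    obtain b z where bz_eq: "bz = (b, z)" by (cases bz)
    define L where "L = lobe (b, z)"
    define B where "B = insert b L"
    have b: "b \<in> W" "b \<noteq> x" and z: "z \<in> W - {x, b}" and yL: "y \<notin> L"
      using bz(1) by (auto simp: good_def bz_eq L_def)
    have L_sub: "L \<subseteq> W - {x, b}"
      unfolding L_def lobe_def using reach_in[OF _ z] by auto
    have zL: "z \<in> L" by (simp add: L_def lobe_def reach_refl)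
    have L_closed: "w \<in> L" if "v \<in> L" "w \<in> W - {x, b}" "adj v w" for v w
      using that L_sub reach_step[of z v "W - {x, b}" w] unfolding L_def lobe_def by auto
    have finL: "finite L" using L_sub fin by (meson finite_Diff finite_subset)
    have L_conn: "conn L"
      unfolding L_def lobe_def using conn_reach_class[OF z] by simp
    have B_sub: "B \<subseteq> W - {x}" using b L_sub by (auto simp: B_def)
    have bL: "b \<notin> L" using L_sub by auto
    \<comment> \<open>The set stays connected without \<open>x\<close>, so \<open>L\<close> has an
      edge to \<open>b\<close>; it stays connected without \<open>b\<close>, so \<open>L\<close> has
      an edge to \<open>x\<close>.\<close>
    obtain b' where b': "b' \<in> L" "adj b' b"
    proof -
      have "(z, b) \<in> reach (W - {x})" using connD[OF nocutD(2)[OF nc]] z b by simp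
      then obtain u v where "u \<in> L \<inter> (W - {x})" "v \<in> W - {x} - L" "adj u v"
        using reach_crossing[OF _ zL bL] by metis
      then show ?thesis using that L_closed by blast
    qed
    obtain x' where x': "x' \<in> L" "adj x' x"
    proof -
      have "(z, x) \<in> reach (W - {b})" using connD[OF nocutD(2)[OF nc]] z b Suc.prems by simp
      moreover have "x \<notin> L" using L_sub by auto
      ultimately obtain u v where "u \<in> L \<inter> (W - {b})" "v \<in> W - {b} - L" "adj u v"
        using reach_crossing[OF _ zL] by metis
      then show ?thesis using that L_closed by blast
    qed
    have "nocut B"
      unfolding nocut_def
    proof (intro conjI allI)
      show B_conn: "conn B"
      proof (rule conn_if_reach[where b = b])
        fix u assume "u \<in> B"
        show "(u, b) \<in> reach B"
        proof (cases "u = b")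
          case False
          then have "(u, b') \<in> reach B"
            using \<open>u \<in> B\<close> reach_mono[of L B, OF _ connD[OF L_conn _ b'(1)]] by (auto simp: B_def)
          then show ?thesis using reach_step[of u b' B b] b' by (auto simp: B_def)
        qed (simp add: reach_refl)
      qed
      fix w
      show "conn (B - {w})"
      proof (cases "w \<in> L")
        case False
        then consider "w = b" | "w \<notin> B" by (auto simp: B_def)
        then show ?thesis
        proof cases
          case 1
          then have "B - {w} = L" using bL by (auto simp: B_def)
          then show ?thesis using L_conn by simp
        qed (use B_conn in simp)
      next
        case w: True
        show ?thesis
        proof (rule conn_if_reach[where b = b], rule ccontr)
          fix u assume u: "u \<in> B - {w}" and nr: "(u, b) \<notin> reach (B - {w})"
          have ub: "u \<noteq> b" using nr reach_refl by metis
          then have uL: "u \<in> L" using u by (auto simp: B_def)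
          \<comment> \<open>If \<open>u\<close> cannot reach \<open>b\<close> in
            \<open>B - {w}\<close>, its component after deleting \<open>x\<close> and
            \<open>w\<close> stays inside \<open>L - {w}\<close>. With \<open>w\<close> in the role
            of \<open>b\<close> it would be a candidate smaller than \<open>L\<close>.\<close>
          have inv: "v \<in> L - {w} \<and> (u, v) \<in> reach (B - {w})" if "(u, v) \<in> reach (W - {x, w})" for v
            using that
          proof (induction rule: reach_induct)
            case refl
            then show ?case using u uL reach_refl by auto
          next
            case (step v v')
            have vB: "v \<in> B - {w}" using step by (auto simp: B_def)
            show ?case
            proof (cases "v' = b")
              case True
              then have "(u, b) \<in> reach (B - {w})"
                using reach_step[of u v "B - {w}" b] step vB bL w by (auto simp: B_def)
              then show ?thesis using nr by simp
            next
              case False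
              then have "v' \<in> L - {w}" using step L_closed by blast
              then show ?thesis using reach_step[of u v "B - {w}" v'] step vB by (auto simp: B_def)
            qed
          qed
          then have sub: "lobe (w, u) \<subseteq> L - {w}" by (auto simp: lobe_def)
          have "good (w, u)"
            unfolding good_def using sub yL w u uL L_sub by auto
          then have "card L \<le> card (lobe (w, u))" using bz(2) by (simp add: bz_eq L_def)
          also have "\<dots> \<le> card (L - {w})" using sub finL by (simp add: card_mono)
          also have "\<dots> < card L" by (rule card_Diff1_less[OF finL w])
          finally show False by simp
        qed
      qed
    qed
    moreover have "d \<le> card (nbrs B v)" if v: "v \<in> B - {b}" for v
    proof -
      have vL: "v \<in> L" using v by (auto simp: B_def)
      have "nbrs W v \<subseteq> insert x (nbrs B v)"
        using L_closed[OF vL] unfolding nbrs_def B_def by blast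
      moreover have fB: "finite (nbrs B v)" using finL by (auto simp: nbrs_def B_def)
      ultimately have "card (nbrs W v) \<le> card (insert x (nbrs B v))" by (simp add: card_mono)
      also have "\<dots> \<le> Suc (card (nbrs B v))" by (rule card_insert_le_m1) (use fB in simp_all)
      finally show ?thesis using Suc.prems(6)[of v] vL L_sub yL by fastforce
    qed
    moreover have "finite B" "x' \<in> B" "b \<in> B" "x' \<noteq> b" using finL x' bL by (auto simp: B_def)
    ultimately obtain p where p: "path_in B p" "hd p = x'" "last p = b" "d + 1 \<le> length p"
      using Suc.IH[of B x' b] by blast
    obtain q where q: "path_in (W - {x}) q" "hd q = b" "last q = y"
      using reach_path[OF connD[OF nocutD(2)[OF nc]]] b Suc.prems by (metis Diff_iff singletonD)
    obtain q' where q': "q = b # q'" using q(1,2) by (cases q) (auto simp: path_in_def)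
    \<comment> \<open>Otherwise \<open>y\<close> would be reachable from \<open>L\<close> while
      avoiding \<open>x\<close> and \<open>b\<close>.\<close>
    have q'L: "set q' \<inter> L = {}"
    proof (rule ccontr)
      assume "\<not> ?thesis"
      then obtain v where v: "v \<in> set q'" "v \<in> L" by auto
      have "last q' = y" "y \<in> set q'" using q q' v by (auto split: if_splits)
      moreover have "successively adj q'" "set q' \<subseteq> W - {x, b}"
        using q(1) q' by (auto simp: path_in_def successively_Cons)
      ultimately have "(v, y) \<in> reach (W - {x, b})" using path_reach v by blast
      then have "y \<in> L" using v unfolding L_def lobe_def using reach_trans by auto
      then show False using yL by simp
    qed
    have "path_in W (x # p @ q')"
    proof -
      have "set p \<inter> set q' = {}"
        using p(1) q(1) q' q'L by (auto simp: path_in_def B_def)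
      moreover have "successively adj (p @ q')"
        using p q q' by (auto simp: path_in_def successively_append_iff successively_Cons)
      ultimately show ?thesis
        using p q q' B_sub x' adj_sym Suc.prems
        by (auto simp: path_in_def successively_Cons)
    qed
    moreover have "last (x # p @ q') = y"
      using p q q' by (cases "q' = []") (auto simp: path_in_def)
    ultimately show ?thesis
      using p(4) by (intro exI[of _ "x # p @ q'"]) simp
  qed
qed


subsection \<open>Subgraphs with many vertices compared to their independence number\<close>

definition alpha :: "'a set \<Rightarrow> nat" where
  "alpha U = Max (card ` {J. J \<subseteq> U \<and> indep J})"

lemma indep_empty: "indep {}"
  by (simp add: indep_def)

lemma alpha_ge:
  assumes "finite U" "J \<subseteq> U" "indep J"
  shows "card J \<le> alpha U"
  unfolding alpha_def using assms by (intro Max_ge) auto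

lemma alpha_obtain:
  assumes "finite U"
  obtains J where "J \<subseteq> U" "indep J" "card J = alpha U"
proof -
  have "alpha U \<in> card ` {J. J \<subseteq> U \<and> indep J}"
    unfolding alpha_def using assms indep_empty by (intro Max_in) auto
  then show ?thesis using that by auto
qed

lemma alpha_mono: "finite W \<Longrightarrow> U \<subseteq> W \<Longrightarrow> alpha U \<le> alpha W"
  by (metis alpha_ge alpha_obtain order.trans finite_subset)

lemma alpha_disconnected:
  assumes "finite X" "finite Y" "X \<inter> Y = {}" "\<And>x y. x \<in> X \<Longrightarrow> y \<in> Y \<Longrightarrow> \<not> adj x y"
  shows "alpha X + alpha Y \<le> alpha (X \<union> Y)"
proof -
  obtain I J where I: "I \<subseteq> X" "indep I" "card I = alpha X" and J: "J \<subseteq> Y" "indep J" "card J = alpha Y"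
    using alpha_obtain assms(1,2) by metis
  have "indep (I \<union> J)"
    using I J assms(4) adj_sym unfolding indep_def by blast
  then have "card (I \<union> J) \<le> alpha (X \<union> Y)" using I J assms by (intro alpha_ge) auto
  moreover have "card (I \<union> J) = card I + card J"
    using I J assms by (intro card_Un_disjoint) (auto intro: finite_subset)
  ultimately show ?thesis using I J by simp
qed

lemma not_conn_split:
  assumes "\<not> conn U"
  obtains X Y where "X \<union> Y = U" "X \<inter> Y = {}" "X \<noteq> {}" "Y \<noteq> {}"
    "\<And>x y. x \<in> X \<Longrightarrow> y \<in> Y \<Longrightarrow> \<not> adj x y"
proof -
  obtain u v where uv: "u \<in> U" "v \<in> U" "(u, v) \<notin> reach U" using assms by (auto simp: conn_def)
  define X where "X = {w. (u, w) \<in> reach U}"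
  have XU: "X \<subseteq> U" unfolding X_def using reach_in uv by blast
  show ?thesis
  proof (rule that[of X "U - X"])
    show "\<not> adj x y" if "x \<in> X" "y \<in> U - X" for x y
      using that XU reach_step[of u x U y] by (auto simp: X_def)
    show "X \<noteq> {}" "U - X \<noteq> {}" using uv reach_refl by (auto simp: X_def)
  qed (use XU in auto)
qed

text \<open>An inclusion-minimal subset with this property is 2-connected and has large minimum degree.\<close>

lemma dense_nocut_subset:
  assumes R: "finite R" "d * alpha R + 1 \<le> card R" and d: "1 \<le> d"
  obtains K where "K \<subseteq> R" "nocut K" "d < card K" "\<And>v. v \<in> K \<Longrightarrow> d \<le> card (nbrs K v)"
proof -
  obtain K where K: "K \<subseteq> R" "d * alpha K + 1 \<le> card K"
    and min: "\<And>K'. K' \<subseteq> R \<Longrightarrow> d * alpha K' + 1 \<le> card K' \<Longrightarrow> card K \<le> card K'"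
    using ex_has_least_nat[where P = "\<lambda>K. K \<subseteq> R \<and> d * alpha K + 1 \<le> card K" and m = card and k = R]
      R(2) by blast
  have finK: "finite K" using K R finite_subset by auto
  \<comment> \<open>By minimality, every proper subset violates the inequality. Independence numbers
    add up over disconnected parts, so \<open>K\<close> must be connected.\<close>
  have small: "card X \<le> d * alpha X" if "X \<subset> K" for X
    using min[of X] that K psubset_card_mono[OF finK that] by (cases "card X \<le> d * alpha X") auto
  have "conn K"
  proof (rule ccontr)
    assume "\<not> ?thesis"
    then obtain X Y where XY: "X \<union> Y = K" "X \<inter> Y = {}" "X \<noteq> {}" "Y \<noteq> {}"
      "\<And>x y. x \<in> X \<Longrightarrow> y \<in> Y \<Longrightarrow> \<not> adj x y" using not_conn_split by metis
    have fin: "finite X" "finite Y" using XY finK by auto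
    have sub: "X \<subset> K" "Y \<subset> K" using XY(1-4) by auto
    have "card K = card X + card Y" using XY fin card_Un_disjoint by metis
    also have "\<dots> \<le> d * (alpha X + alpha Y)"
      using small[OF sub(1)] small[OF sub(2)] by (simp add: distrib_left)
    also have "\<dots> \<le> d * alpha K"
      using alpha_disconnected[OF fin XY(2,5)] XY(1) by simp
    finally show False using K by simp
  qed
  moreover have "conn (K - {z})" for z
  proof (cases "z \<in> K")
    case z: True
    show ?thesis
    proof (rule ccontr)
      assume "\<not> ?thesis"
      then obtain X Y where XY: "X \<union> Y = K - {z}" "X \<inter> Y = {}" "X \<noteq> {}" "Y \<noteq> {}"
        "\<And>x y. x \<in> X \<Longrightarrow> y \<in> Y \<Longrightarrow> \<not> adj x y" using not_conn_split by metis
      have fin: "finite X" "finite Y"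
        using XY(1) finK by (metis finite_Diff finite_Un)+
      have zXY: "z \<notin> X" "z \<notin> Y" using XY(1) by auto
      have sub: "X \<subset> K" "Y \<subset> K" "insert z X \<subset> K" "insert z Y \<subset> K" using XY(1-4) z by auto
      have "card (K - {z}) = card X + card Y" using XY(1,2) fin card_Un_disjoint by metis
      then have cK: "card K = card X + card Y + 1" using card_Suc_Diff1[OF finK z] by simp
      have aXY: "alpha X + alpha Y \<le> alpha K"
        using alpha_disconnected[OF fin XY(2,5)] alpha_mono[OF finK, of "K - {z}"] XY(1) by simp
      then have dXY: "d * alpha X + d * alpha Y \<le> d * alpha K"
        by (metis distrib_left mult_le_mono2)
      have bX: "card X + 1 \<le> d * alpha (insert z X)" and bY: "card Y + 1 \<le> d * alpha (insert z Y)"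
        using small[OF sub(3)] small[OF sub(4)] zXY fin by simp_all
      have sX: "card X \<le> d * alpha X" and sY: "card Y \<le> d * alpha Y"
        using small sub by auto
      obtain I J where I: "I \<subseteq> insert z X" "indep I" "card I = alpha (insert z X)"
        and J: "J \<subseteq> insert z Y" "indep J" "card J = alpha (insert z Y)"
        using alpha_obtain fin finite_insert by metis
      \<comment> \<open>If \<open>z\<close> did not raise the independence number of
        \<open>X\<close>, the bounds for \<open>insert z X\<close> and \<open>Y\<close> would add up
        to the failure of the inequality for \<open>K\<close>.\<close>
      have X_lt: "alpha X < card I"
      proof (rule ccontr)
        assume "\<not> ?thesis"
        then have "d * card I \<le> d * alpha X" by simp
        then show False using bX sY dXY cK K(2) unfolding I(3) by linarith
      qed
      have Y_lt: "alpha Y < card J"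
      proof (rule ccontr)
        assume "\<not> ?thesis"
        then have "d * card J \<le> d * alpha Y" by simp
        then show False using bY sX dXY cK K(2) unfolding J(3) by linarith
      qed
      \<comment> \<open>Maximum independent sets of both enlarged parts thus contain
        \<open>z\<close>. Glued there, they exceed \<open>alpha X + alpha Y\<close> by at least one,
        which pays for the vertex \<open>z\<close> since \<open>1 \<le> d\<close>.\<close>
      have zI: "z \<in> I" using alpha_ge[OF fin(1) _ I(2)] I(1) X_lt by fastforce
      have zJ: "z \<in> J" using alpha_ge[OF fin(2) _ J(2)] J(1) Y_lt by fastforce
      have "indep (I \<union> J)"
        unfolding indep_def
      proof (intro ballI notI)
        fix u v assume "u \<in> I \<union> J" "v \<in> I \<union> J" "adj u v"
        moreover have "\<not> adj u v" if "u \<in> I" "v \<in> J" for u v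
        proof (cases "u = z \<or> v = z")
          case True
          then show ?thesis using that I J zI zJ by (auto simp: indep_def)
        next
          case False
          then show ?thesis using that I J XY(5) by blast
        qed
        ultimately show False using I(2) J(2) adj_sym unfolding indep_def by blast
      qed
      then have "card (I \<union> J) \<le> alpha K"
        using I J sub by (intro alpha_ge[OF finK]) auto
      moreover have "card (I \<union> J) + 1 = card I + card J"
      proof -
        have "I \<inter> J = {z}" using I(1) J(1) zI zJ XY(2) by auto
        then show ?thesis
          using card_Un_Int[of I J] I(1) J(1) fin by (simp add: finite_subset[of _ "insert z X"] finite_subset[of _ "insert z Y"])
      qed
      ultimately have "alpha X + alpha Y + 1 \<le> alpha K" using X_lt Y_lt by simp
      then have "d * alpha X + d * alpha Y + d \<le> d * alpha K"
        by (metis distrib_left mult_le_mono2 nat_mult_1_right)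
      then show False using sX sY cK K(2) d by simp
    qed
  qed (use \<open>conn K\<close> in simp)
  ultimately have "nocut K" by (simp add: nocut_def)
  moreover have deg: "d \<le> card (nbrs K v)" if v: "v \<in> K" for v
  proof (rule ccontr)
    assume deg: "\<not> ?thesis"
    \<comment> \<open>Deleting \<open>v\<close> with its fewer than \<open>d\<close> neighbours
      costs at most \<open>d\<close> vertices but lowers the independence number, so the rest would
      still satisfy the inequality.\<close>
    define N where "N = insert v (nbrs K v)"
    have N: "N \<subseteq> K" "finite N" "v \<in> N" using v finK by (auto simp: N_def nbrs_def)
    have "card N \<le> d" using deg N(2) by (simp add: N_def card_insert_if)
    obtain J where J: "J \<subseteq> K - N" "indep J" "card J = alpha (K - N)"
      using alpha_obtain finK finite_Diff by metis
    have "indep (insert v J)"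
      using J adj_irrefl adj_sym by (auto simp: indep_def N_def nbrs_def)
    then have "card (insert v J) \<le> alpha K" using J v by (intro alpha_ge[OF finK]) auto
    moreover have "v \<notin> J" "finite J" using J N finK by (auto intro: finite_subset)
    ultimately have "alpha (K - N) + 1 \<le> alpha K" using J by simp
    then have "d * alpha (K - N) + d \<le> d * alpha K"
      by (metis distrib_left mult_le_mono2 nat_mult_1_right)
    moreover have "card K \<le> card (K - N) + d"
      using \<open>card N \<le> d\<close> card_Diff_subset[OF N(2,1)] by simp
    ultimately have "d * alpha (K - N) + 1 \<le> card (K - N)" using K(2) by simp
    then have "card K \<le> card (K - N)" using K(1) by (intro min) auto
    moreover have "card (K - N) < card K" using N finK v by (intro psubset_card_mono) auto
    ultimately show False by simp
  qed
  moreover have "d < card K"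
  proof -
    have "K \<noteq> {}" using K(2) by auto
    then obtain v where v: "v \<in> K" by auto
    have "nbrs K v \<subset> K" using v adj_irrefl by (auto simp: nbrs_def)
    then have "card (nbrs K v) < card K" by (rule psubset_card_mono[OF finK])
    then show ?thesis using deg[OF v] by simp
  qed
  ultimately show ?thesis using that K(1) by blast
qed


subsection \<open>Longest cycles\<close>

definition longest_cyc :: "'a list \<Rightarrow> bool" where
  "longest_cyc c \<longleftrightarrow> cyc c \<and> (\<forall>c'. cyc c' \<longrightarrow> length c' \<le> length c)"

definition attach :: "'a list \<Rightarrow> 'a \<Rightarrow> 'a set" where
  "attach c h = {a \<in> set c. \<exists>v. (h, v) \<in> reach (V - set c) \<and> adj v a}"

text \<open>Replacing either arc between \<open>a\<close> and \<open>b\<close> by \<open>Q\<close>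
  yields a cycle.\<close>

lemma ear_arc:
  assumes c: "cyc (a # A @ b # B)" and len: "\<And>c'. cyc c' \<Longrightarrow> length c' \<le> length (a # A @ b # B)"
    and Q: "path_in (V - set (a # A @ b # B)) Q" "adj a (hd Q)" "adj (last Q) b"
  shows "length Q \<le> length A" "length Q \<le> length B"
proof -
  have "cyc (a # Q @ b # B)"
    using c Q unfolding cyc_def path_in_def
    by (auto simp: successively_Cons successively_append_iff split: if_splits)
      (auto simp: Suc_le_eq)
  from len[OF this] show "length Q \<le> length A" by simp
  have "successively adj (rev Q)" using Q by (simp add: path_in_def successively_rev_adj del: successively_rev)
  then have "cyc (a # A @ b # rev Q)"
    using c Q adj_sym unfolding cyc_def path_in_def
    by (auto simp: successively_Cons successively_append_iff hd_rev last_rev Suc_le_eq hd_append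
        simp del: successively_rev split: if_splits)
  from len[OF this] show "length Q \<le> length B" by simp
qed

lemma ear_bound:
  assumes c: "longest_cyc c" and ab: "a \<in> set c" "b \<in> set c" "a \<noteq> b"
    and Q: "path_in (V - set c) Q" "adj a (hd Q)" "adj (last Q) b"
  shows "2 * length Q + 2 \<le> length c"
proof -
  obtain xs where xs: "cyc (a # xs)" "set (a # xs) = set c" "length (a # xs) = length c"
    using cyc_from c ab by (metis longest_cyc_def)
  then have "b \<in> set xs" using ab by auto
  then obtain A B where AB: "xs = A @ b # B" by (meson split_list)
  have "length Q \<le> length A" "length Q \<le> length B"
    using ear_arc[of a A b B Q] xs c Q AB unfolding longest_cyc_def by metis+
  moreover have "length c = length A + length B + 2" using xs(3) AB by simp
  ultimately show ?thesis by simp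
qed

text \<open>Going through \<open>a\<close>, \<open>Q\<close>, \<open>b\<close>, \<open>A\<close>
  backwards, \<open>Q'\<close> and \<open>B\<close> gives a cycle that keeps all old vertices and
  gains those of \<open>Q\<close>. An empty \<open>Q'\<close> stands for an edge between the two
  successors.\<close>

lemma no_crossing:
  assumes c: "cyc (a # A @ b # B)" and len: "\<And>c'. cyc c' \<Longrightarrow> length c' \<le> length (a # A @ b # B)"
    and Q: "path_in (V - set (a # A @ b # B)) Q" "adj a (hd Q)" "adj (last Q) b"
    and AB: "A \<noteq> []" "B \<noteq> []"
    and Q': "set Q' \<subseteq> V - set (a # A @ b # B) - set Q" "distinct Q'"
      "successively adj (hd A # Q' @ [hd B])"
  shows False
proof -
  have "successively adj (rev A)"
    using c by (simp add: cyc_def path_in_def successively_rev_adj successively_append_iff successively_Cons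
        del: successively_rev)
  then have "cyc (a # Q @ b # rev A @ Q' @ B)"
    using c Q Q' AB adj_sym unfolding cyc_def path_in_def
    by (cases "Q' = []")
      (auto simp: successively_Cons successively_append_iff hd_rev last_rev Suc_le_eq hd_append
        simp del: successively_rev split: if_splits)
  from len[OF this] have "length Q = 0" by simp
  then show False using Q by (simp add: path_in_def)
qed

text \<open>Appending the opposite end before taking \<open>hd\<close> covers empty arcs, where the
  successor of one end is the other end.\<close>

lemma split_cycle_at:
  assumes "cyc c" "i < length c" "j < length c" "i \<noteq> j"
  obtains A B where "cyc (c ! i # A @ c ! j # B)" "set (c ! i # A @ c ! j # B) = set c"
    "length (c ! i # A @ c ! j # B) = length c"
    "hd (A @ [c ! j]) = c ! (Suc i mod length c)" "hd (B @ [c ! i]) = c ! (Suc j mod length c)"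
proof -
  have main: "\<exists>A B. cyc (c ! i # A @ c ! j # B) \<and> set (c ! i # A @ c ! j # B) = set c \<and>
    length (c ! i # A @ c ! j # B) = length c \<and>
    hd (A @ [c ! j]) = c ! (Suc i mod length c) \<and> hd (B @ [c ! i]) = c ! (Suc j mod length c)"
    if ij: "i < j" "j < length c" for i j
  proof -
    define P where "P = take i c"
    define A where "A = take (j - Suc i) (drop (Suc i) c)"
    define B where "B = drop (Suc j) c"
    have c1: "c = P @ c ! i # drop (Suc i) c" using ij by (simp add: P_def id_take_nth_drop)
    have c2: "drop (Suc i) c = A @ c ! j # B"
      using id_take_nth_drop[of "j - Suc i" "drop (Suc i) c"] ij by (simp add: A_def B_def)
    have c3: "c = P @ c ! i # A @ c ! j # B" using c1 c2 by simp
    have lP: "length P = i" using ij by (simp add: P_def)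
    have lA: "length A = j - Suc i" using ij by (simp add: A_def)
    have "hd (A @ [c ! j]) = c ! Suc i"
    proof -
      have "c ! Suc i = drop (Suc i) c ! 0" using ij by simp
      also have "\<dots> = hd (A @ [c ! j])" by (simp add: c2 nth_append hd_conv_nth)
      finally show ?thesis by simp
    qed
    moreover have "Suc i mod length c = Suc i" using ij by simp
    moreover have "hd ((B @ P) @ [c ! i]) = c ! (Suc j mod length c)"
    proof (cases "Suc j = length c")
      case True
      then have "B = []" by (simp add: B_def)
      moreover have "hd (P @ [c ! i]) = c ! 0"
      proof -
        have "c \<noteq> []" using ij by auto
        then have "c ! 0 = hd c" by (simp add: hd_conv_nth)
        also have "\<dots> = hd (P @ [c ! i])" using arg_cong[OF c3, of hd] by (cases P) auto
        finally show ?thesis by simp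
      qed
      ultimately show ?thesis using True by simp
    next
      case False
      then have "B \<noteq> []" "hd B = c ! Suc j" using ij by (auto simp: B_def hd_drop_conv_nth)
      then show ?thesis using False ij by simp
    qed
    moreover have "cyc (c ! i # A @ c ! j # B @ P)"
      using cyc_rotate[of P "c ! i # A @ c ! j # B"] assms(1) c3 by simp
    moreover have "set (c ! i # A @ c ! j # B @ P) = set c"
      by (subst (3) c3) auto
    moreover have "length (c ! i # A @ c ! j # B @ P) = length c"
      using arg_cong[OF c3, of length] by simp
    ultimately show ?thesis by (intro exI[of _ A] exI[of _ "B @ P"]) simp
  qed
  show ?thesis
  proof (cases "i < j")
    case True
    then show ?thesis using main[of i j] assms that by blast
  next
    case False
    then obtain A B where AB: "cyc (c ! j # A @ c ! i # B)" "set (c ! j # A @ c ! i # B) = set c"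
      "length (c ! j # A @ c ! i # B) = length c"
      "hd (A @ [c ! i]) = c ! (Suc j mod length c)" "hd (B @ [c ! j]) = c ! (Suc i mod length c)"
      using main[of j i] assms by auto
    have "cyc (c ! i # B @ c ! j # A)" using cyc_rotate[of "c ! j # A" "c ! i # B"] AB(1) by simp
    then show ?thesis by (rule that) (use AB in auto)
  qed
qed

text \<open>The set \<open>P\<close> consists of the successors on the cycle of the attachment vertices of the component
  of \<open>h\<close>. The labelling \<open>f\<close> witnesses that \<open>h\<close> and the vertices of \<open>P\<close> lie in pairwise different
  components once the other cycle vertices are removed.\<close>

lemma attachment_successors_separated:
  assumes c: "longest_cyc c" and h: "h \<in> V - set c"
  obtains P and f :: "'a \<Rightarrow> 'a" where "P \<subseteq> set c - attach c h" "card P = card (attach c h)"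
    "inj_on f (insert h P)"
    "\<And>u v. u \<notin> set c - P \<Longrightarrow> v \<notin> set c - P \<Longrightarrow> adj u v \<Longrightarrow> f u = f v"
proof -
  define R where "R = V - set c"
  define H where "H = {v. (h, v) \<in> reach R}"
  define N where "N = attach c h"
  define L where "L = length c"
  define I where "I = {i. i < L \<and> c ! i \<in> N}"
  define s where "s = (\<lambda>i. c ! (Suc i mod L))"
  define P where "P = s ` I"
  have cc: "cyc c" and len: "\<And>c'. cyc c' \<Longrightarrow> length c' \<le> length c"
    using c by (auto simp: longest_cyc_def)
  have L: "3 \<le> L" and dc: "distinct c" using cyc_simps[OF cc] by (auto simp: L_def)
  have hR: "h \<in> R" using h by (simp add: R_def)
  have HR: "H \<subseteq> R" using reach_in[OF _ hR] by (auto simp: H_def)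
  have N_iff: "a \<in> N \<longleftrightarrow> a \<in> set c \<and> (\<exists>v\<in>H. adj v a)" for a
    by (auto simp: N_def attach_def H_def R_def)
  have s_in: "s i \<in> set c" if "i \<in> I" for i
    unfolding s_def L_def using L by (intro nth_mem mod_less_divisor) (auto simp: L_def)
  \<comment> \<open>Two attachment vertices are joined by an ear through \<open>H\<close>; neither
    arc can be shorter than it, so both are nonempty.\<close>
  have arc: "\<exists>A B Q. cyc (c ! i # A @ c ! j # B) \<and> set (c ! i # A @ c ! j # B) = set c
      \<and> length (c ! i # A @ c ! j # B) = length c
      \<and> A \<noteq> [] \<and> B \<noteq> [] \<and> hd A = s i \<and> hd B = s j
      \<and> path_in R Q \<and> set Q \<subseteq> H \<and> adj (c ! i) (hd Q) \<and> adj (last Q) (c ! j)"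
    if ij: "i \<in> I" "j \<in> I" "i \<noteq> j" for i j
  proof -
    obtain A B where AB: "cyc (c ! i # A @ c ! j # B)" "set (c ! i # A @ c ! j # B) = set c"
      "length (c ! i # A @ c ! j # B) = length c"
      "hd (A @ [c ! j]) = s i" "hd (B @ [c ! i]) = s j"
      using split_cycle_at[OF cc, of i j] ij unfolding I_def L_def s_def by blast
    obtain u v where uv: "u \<in> H" "adj u (c ! i)" "v \<in> H" "adj v (c ! j)"
      using ij by (auto simp: I_def N_iff)
    have "(u, v) \<in> reach H"
      using conn_reach_class[OF hR] uv unfolding conn_def H_def by blast
    then obtain Q where Q: "path_in H Q" "hd Q = u" "last Q = v" using reach_path uv by metis
    have QR: "path_in R Q" "set Q \<subseteq> H" using Q HR by (auto simp: path_in_def)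
    have "length Q \<le> length A" "length Q \<le> length B"
      using ear_arc[of "c ! i" A "c ! j" B Q] AB QR Q uv len adj_sym unfolding R_def by metis+
    moreover have "0 < length Q" using Q by (simp add: path_in_def)
    ultimately have "A \<noteq> []" "B \<noteq> []" by auto
    moreover have "adj (c ! i) (hd Q)" "adj (last Q) (c ! j)" using Q uv adj_sym by auto
    ultimately show ?thesis
      using AB QR by (intro exI[of _ A] exI[of _ B] exI[of _ Q]) simp
  qed
  \<comment> \<open>Two successors joined by an edge, or by a path off \<open>c\<close> outside
    \<open>H\<close>, would give the longer cycle of \<open>no_crossing\<close>.\<close>
  have cross: False
    if ij: "i \<in> I" "j \<in> I" "i \<noteq> j" and Q': "set Q' \<subseteq> R - H" "distinct Q'" "successively adj (s i # Q' @ [s j])"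
    for i j Q'
  proof -
    obtain A B Q where AB: "cyc (c ! i # A @ c ! j # B)" "set (c ! i # A @ c ! j # B) = set c"
      "length (c ! i # A @ c ! j # B) = length c" "A \<noteq> []" "B \<noteq> []" "hd A = s i" "hd B = s j"
      and Q: "path_in R Q" "set Q \<subseteq> H" "adj (c ! i) (hd Q)" "adj (last Q) (c ! j)"
      using arc[OF ij] by blast
    show False
    proof (rule no_crossing[OF AB(1) _ _ Q(3,4) AB(4,5)])
      show "set Q' \<subseteq> V - set (c ! i # A @ c ! j # B) - set Q"
        using Q' Q(2) unfolding AB(2) R_def by blast
    qed (use len AB Q Q' in \<open>auto simp: R_def simp del: successively.simps\<close>)
  qed
  have PN: "P \<subseteq> set c - N"
  proof
    fix w assume "w \<in> P"
    then obtain i where i: "i \<in> I" "w = s i" by (auto simp: P_def)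
    have "w \<notin> N"
    proof
      assume wN: "w \<in> N"
      define j where "j = Suc i mod L"
      have iL: "i < L" using i by (simp add: I_def)
      have "j \<noteq> i" using iL L by (auto simp: j_def mod_Suc)
      moreover have "j \<in> I" using wN L i by (simp add: I_def j_def s_def)
      ultimately obtain A B where AB: "cyc (c ! i # A @ c ! j # B)" "A \<noteq> []" "hd A = s i"
        using arc[of i j] i by blast
      have "s i = c ! j" by (simp add: s_def j_def)
      moreover have "hd A \<noteq> c ! j" using cyc_simps(2)[OF AB(1)] hd_in_set[OF AB(2)] by auto
      ultimately show False using AB by simp
    qed
    then show "w \<in> set c - N" using s_in i by simp
  qed
  have inj_s: "inj_on s I"
  proof (rule inj_onI)
    fix i j assume ij: "i \<in> I" "j \<in> I" "s i = s j"
    have "Suc i mod L = Suc j mod L"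
    proof -
      have "Suc i mod L < L" "Suc j mod L < L" using L by simp_all
      then show ?thesis using nth_eq_iff_index_eq[OF dc] ij(3) unfolding s_def L_def by blast
    qed
    then show "i = j" using ij(1,2) by (auto simp: I_def mod_Suc split: if_splits)
  qed
  have "N = (\<lambda>i. c ! i) ` I"
  proof -
    have "N \<subseteq> set c" using N_iff by blast
    then show ?thesis unfolding I_def L_def by (auto simp: in_set_conv_nth image_def subset_iff)
  qed
  moreover have "inj_on (\<lambda>i. c ! i) I"
    using dc by (auto simp: inj_on_def I_def L_def nth_eq_iff_index_eq)
  ultimately have "card N = card I" by (simp add: card_image)
  then have card_P: "card P = card N" using inj_s by (simp add: P_def card_image)
  have PR: "P \<inter> R = {}" using PN by (auto simp: R_def)
  \<comment> \<open>A vertex off \<open>c\<close> is labelled by the vertex of \<open>P\<close> to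
    which its component is attached, or by \<open>h\<close> if there is none; \<open>uniq\<close>
    makes the choice unambiguous.\<close>
  define att where "att = (\<lambda>v w. w \<in> P \<and> (\<exists>v'. (v, v') \<in> reach R \<and> adj v' w))"
  define f where "f = (\<lambda>v. if v \<in> P then v else if \<exists>w. att v w then SOME w. att v w else h)"
  \<comment> \<open>\<open>H\<close> attaches only to \<open>N\<close>, which is disjoint from
    \<open>P\<close>; so \<open>H\<close> keeps the label \<open>h\<close>.\<close>
  have att_H: "\<not> att v w" if "v \<in> H" for v w
  proof
    assume "att v w"
    then obtain v' where v': "w \<in> P" "(v, v') \<in> reach R" "adj v' w" by (auto simp: att_def)
    then have "v' \<in> H" using that reach_trans by (auto simp: H_def)
    then have "w \<in> N" using v' PN N_iff by blast
    then show False using v' PN by blast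
  qed
  \<comment> \<open>Two successors attached to the same component could be joined through it,
    against \<open>cross\<close>.\<close>
  have uniq: "w = w'" if v: "v \<in> R" "att v w" "att v w'" for v w w'
  proof -
    obtain i j u u' where ij: "i \<in> I" "w = s i" "(v, u) \<in> reach R" "adj u w"
      "j \<in> I" "w' = s j" "(v, u') \<in> reach R" "adj u' w'"
      using v by (auto simp: att_def P_def)
    define X where "X = {x. (v, x) \<in> reach R}"
    have "v \<notin> H" using att_H v by blast
    have XH: "X \<subseteq> R - H"
      using reach_in[OF _ v(1)] \<open>v \<notin> H\<close> reach_sym reach_trans unfolding X_def H_def by blast
    have "(u, u') \<in> reach X" using conn_reach_class[OF v(1)] ij unfolding conn_def X_def by blast
    then obtain Q where Q: "path_in X Q" "hd Q = u" "last Q = u'"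
      using reach_path[of u u' X] ij by (auto simp: X_def)
    have Qs: "set Q \<subseteq> R - H" "distinct Q" "successively adj (s i # Q @ [s j])"
      using Q XH ij adj_sym by (auto simp: path_in_def successively_Cons successively_append_iff)
    show ?thesis using cross[OF ij(1,5) _ Qs] ij by blast
  qed
  have RP: "f u = f w" if "u \<in> R" "w \<in> P" "adj u w" for u w
  proof -
    have "att u w" using that reach_refl by (auto simp: att_def)
    moreover from this have "(SOME w. att u w) = w" using uniq[OF that(1)] by (intro some_equality) auto
    moreover have "u \<notin> P" using that PR by auto
    ultimately show ?thesis using that unfolding f_def by auto
  qed
  have f_adj: "f u = f v" if uv: "u \<notin> set c - P" "v \<notin> set c - P" "adj u v" for u v
  proof -
    have in_RP: "u \<in> R \<or> u \<in> P" "v \<in> R \<or> v \<in> P" using uv adj_V[OF uv(3)] by (auto simp: R_def)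
    consider "u \<in> R" "v \<in> R" | "u \<in> R" "v \<in> P" | "u \<in> P" "v \<in> R" | "u \<in> P" "v \<in> P"
      using in_RP by blast
    then show ?thesis
    proof cases
      case 1
      have "(u, v) \<in> reach R" using reach_step[OF reach_refl 1 uv(3)] .
      then have "(u, x) \<in> reach R \<longleftrightarrow> (v, x) \<in> reach R" for x
        using reach_sym reach_trans by metis
      then have "att u = att v" by (auto simp: att_def)
      moreover have "u \<notin> P" "v \<notin> P" using 1 PR by auto
      ultimately show ?thesis by (auto simp: f_def)
    next
      case 4
      then obtain i j where ij: "i \<in> I" "u = s i" "j \<in> I" "v = s j" by (auto simp: P_def)
      moreover have "i \<noteq> j" using uv ij adj_irrefl by auto
      ultimately show ?thesis using cross[of i j "[]"] uv by simp
    qed (use RP uv adj_sym in metis)+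
  qed
  have "h \<in> H" by (simp add: H_def reach_refl)
  then have "f h = h" using att_H hR PR by (auto simp: f_def)
  then have "inj_on f (insert h P)" using hR PR by (auto simp: inj_on_def f_def)
  then show ?thesis using that PN card_P f_adj unfolding N_def by blast
qed


subsection \<open>Circumference\<close>

lemma cyc_length_le: "cyc c \<Longrightarrow> length c \<le> card V"
  using cyc_simps(3,7) card_mono[OF finite_V] by metis

lemma circumference_eq: "circumference V E = Max (insert 0 {length c | c. cyc c})"
  by (simp add: circumference_def is_cycle_iff_cyc)

lemma finite_cycle_lengths: "finite {length c | c. cyc c}"
  by (rule finite_subset[of _ "{..card V}"]) (auto dest: cyc_length_le)

lemma circumference_ge: "cyc c \<Longrightarrow> length c \<le> circumference V E"
  unfolding circumference_eq using finite_cycle_lengths by (intro Max_ge) auto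

lemma circumference_le: "(\<And>c. cyc c \<Longrightarrow> length c \<le> m) \<Longrightarrow> circumference V E \<le> m"
  unfolding circumference_eq using finite_cycle_lengths by (intro Max.boundedI) auto

lemma longest_cyc_exists:
  assumes "cyc c"
  obtains c' where "longest_cyc c'"
  using ex_has_greatest_nat[of cyc c length "Suc (card V)"] assms cyc_length_le that
  unfolding longest_cyc_def by (metis le_imp_less_Suc)

lemma longest_cycD: "longest_cyc c \<Longrightarrow> cyc c" "longest_cyc c \<Longrightarrow> cyc c' \<Longrightarrow> length c' \<le> length c"
  by (auto simp: longest_cyc_def)

text \<open>Smaller sets are padded to \<open>k\<close> vertices.\<close>

lemma k_cyclable_cycle:
  assumes "k_cyclable k V E" "k \<le> card V" "S \<subseteq> V" "card S \<le> k"
  obtains D where "cyc D" "S \<subseteq> set D"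
proof -
  obtain S' where "S \<subseteq> S'" "S' \<subseteq> V" "card S' = k"
    using exists_subset_between[OF assms(4,2,3) finite_V] by blast
  then have "cyclable V E S'" using assms(1) by (simp add: k_cyclable_def)
  then obtain D where "cyc D" "S' \<subseteq> set D" by (auto simp: cyclable_def is_cycle_iff_cyc)
  then show ?thesis using that \<open>S \<subseteq> S'\<close> by auto
qed

lemma card_disjoint_le_length:
  assumes "cyc D" "S \<subseteq> set D" "S \<inter> T = {}"
  shows "card S + card (T \<inter> set D) \<le> length D"
proof -
  have "card S + card (T \<inter> set D) = card (S \<union> (T \<inter> set D))"
    using assms by (intro card_Un_disjoint[symmetric]) (auto intro: finite_subset)
  also have "\<dots> \<le> card (set D)" using assms by (intro card_mono) auto
  finally show ?thesis using cyc_simps(7)[OF assms(1)] by simp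
qed

text \<open>The attachment set separates \<open>h\<close> from \<open>x\<close>; the label is
  membership in the component of \<open>h\<close>.\<close>

lemma card_attach_cycle:
  assumes c: "longest_cyc c" and h: "h \<in> V - set c" and x: "x \<in> set c - attach c h"
    and D: "cyc D" "h \<in> set D" "x \<in> set D"
  shows "2 \<le> card (attach c h \<inter> set D)"
proof -
  define R where "R = V - set c"
  define f where "f = (\<lambda>v. (h, v) \<in> reach R)"
  have hR: "h \<in> R" using h by (simp add: R_def)
  have fimp: "f v" if "u \<notin> attach c h" "v \<notin> attach c h" "adj u v" "f u" for u v
  proof -
    have "u \<in> R" using that(4) reach_in hR unfolding f_def by blast
    moreover have "v \<in> R"
    proof (rule ccontr)
      assume "v \<notin> R"
      then have "v \<in> set c" using adj_V[OF that(3)] by (simp add: R_def)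
      then have "v \<in> attach c h" using that by (auto simp: attach_def f_def R_def)
      then show False using that by simp
    qed
    ultimately show ?thesis using that reach_step unfolding f_def by blast
  qed
  have "f h" by (simp add: f_def reach_refl)
  moreover have "\<not> f x" using x reach_in[OF _ hR, of x] by (auto simp: f_def R_def)
  moreover have hx: "h \<noteq> x" using h x by auto
  ultimately have "inj_on f {h, x}" by auto
  moreover have "{h, x} \<inter> attach c h = {}" using h x by (auto simp: attach_def)
  moreover have "f u = f v" if "u \<notin> attach c h" "v \<notin> attach c h" "adj u v" for u v
    using fimp that adj_sym by blast
  ultimately have "card {h, x} \<le> card (attach c h \<inter> set D)"
    using D hx by (intro card_separated_cycle[where f = f]) auto
  then show ?thesis using hx by simp
qed

text \<open>The successors of attachment vertices are not attachment vertices themselves.\<close>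

lemma attach_proper:
  assumes c: "longest_cyc c" and h: "h \<in> V - set c"
  obtains x where "x \<in> set c - attach c h"
proof (cases "attach c h = {}")
  case True
  then show ?thesis using that cyc_simps(1)[OF longest_cycD(1)[OF c]] by (metis Diff_empty hd_in_set)
next
  case False
  obtain P f where P: "P \<subseteq> set c - attach c h" "card P = card (attach c h)"
    using attachment_successors_separated[OF c h] by metis
  have "finite (attach c h)" by (simp add: attach_def)
  then have "P \<noteq> {}" using False P by auto
  then show ?thesis using that P by blast
qed

section \<open>The lower bound k + 2\<close>

lemma circumference_ge_k_plus_two:
  assumes kc: "k_cyclable k V E" and k: "2 \<le> k" "k \<le> card V" and n: "4 * (k + 1) \<le> 3 * card V"
  shows "k + 2 \<le> circumference V E"
proof (rule ccontr)
  assume neg: "\<not> ?thesis"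
  have short: "length D \<le> k + 1" if "cyc D" for D
    using circumference_ge[OF that] neg by simp
  obtain c0 where "cyc c0" using k_cyclable_cycle[OF kc k(2), of "{}"] by auto
  then obtain c where c: "longest_cyc c" using longest_cyc_exists by metis
  note cc = longest_cycD(1)[OF c]
  have L: "length c \<le> k + 1" using short[OF cc] .
  have setc: "set c \<subseteq> V" "card (set c) = length c" using cyc_simps[OF cc] by auto
  have "card (set c) < card V" using L setc n k by simp
  then obtain h where h: "h \<in> V - set c" using setc by (metis Diff_iff less_irrefl subsetI subset_antisym)
  define N where "N = attach c h"
  have N: "N \<subseteq> set c" "finite N" by (auto simp: N_def attach_def)
  obtain x where x: "x \<in> set c - N" using attach_proper[OF c h] unfolding N_def by blast
  obtain P and f :: "'a \<Rightarrow> 'a" where P: "P \<subseteq> set c - N" "card P = card N" "inj_on f (insert h P)"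
    and f: "\<And>u v. u \<notin> set c - P \<Longrightarrow> v \<notin> set c - P \<Longrightarrow> adj u v \<Longrightarrow> f u = f v"
    using attachment_successors_separated[OF c h] unfolding N_def by metis
  \<comment> \<open>Otherwise some \<open>k\<close> vertices off \<open>N\<close>, among them
    \<open>h\<close> and \<open>x\<close>, lie on a cycle that needs two further vertices from
    \<open>N\<close>.\<close>
  have m: "card V < card N + k"
  proof (rule ccontr)
    assume "\<not> ?thesis"
    moreover have "card (V - N) = card V - card N" using N setc by (intro card_Diff_subset) auto
    ultimately have "k \<le> card (V - N)" by simp
    moreover have "{h, x} \<subseteq> V - N" using h x N setc by auto
    moreover have "card {h, x} \<le> k" using k by (simp add: card_insert_if)
    ultimately obtain S where S: "{h, x} \<subseteq> S" "S \<subseteq> V - N" "card S = k"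
      using exists_subset_between[of "{h, x}" k "V - N"] finite_V by blast
    then obtain D where D: "cyc D" "S \<subseteq> set D"
      using k_cyclable_cycle[OF kc k(2), of S] S(2,3)
      by (metis Diff_subset order.refl order.trans)
    then have "2 \<le> card (N \<inter> set D)"
      using card_attach_cycle[OF c h _ D(1)] x S unfolding N_def by blast
    moreover have "card S + card (N \<inter> set D) \<le> length D"
      using D S by (intro card_disjoint_le_length) auto
    ultimately show False using short[OF D(1)] S by simp
  qed
  define T where "T = set c - P"
  have finP: "finite P" using P(1) finite_subset by blast
  have hP: "h \<notin> P" using h P by auto
  have "card T = length c - card N"
    using card_Diff_subset[OF finP, of "set c"] P setc unfolding T_def by (metis Diff_subset order_trans)
  moreover have "card N \<le> length c" using card_mono[OF _ N(1)] setc by simp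
  moreover have "card (V - T) = card V - card T"
    using setc by (intro card_Diff_subset) (auto simp: T_def)
  moreover have "length c \<le> card V" using cyc_length_le[OF cc] .
  ultimately have cVT: "card (V - T) = card V - length c + card N" by simp
  have PVT: "insert h P \<subseteq> V - T" using P h setc by (auto simp: T_def)
  \<comment> \<open>\<open>V - T\<close> consists of \<open>P\<close> and the vertices off
    \<open>c\<close>. If it has at least \<open>k\<close> elements, a \<open>k\<close>-subset with
    two separated vertices already forces length \<open>k + 2\<close>; otherwise all of it lies on
    one cycle.\<close>
  show False
  proof (cases "k \<le> card (V - T)")
    case True
    have "P \<noteq> {}" using P(2) m k(2) by auto
    then obtain w where w: "w \<in> P" by auto
    have hw: "h \<noteq> w" using hP w by auto
    have "{h, w} \<subseteq> V - T" "card {h, w} \<le> k" using PVT w k by (auto simp: card_insert_if)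
    then obtain S where S: "{h, w} \<subseteq> S" "S \<subseteq> V - T" "card S = k"
      using exists_subset_between[of "{h, w}" k "V - T"] finite_V True by blast
    then obtain D where D: "cyc D" "S \<subseteq> set D"
      using k_cyclable_cycle[OF kc k(2), of S] S(2,3)
      by (metis Diff_subset order.refl order.trans)
    have "inj_on f {h, w}" using P(3) w by (auto intro: inj_on_subset)
    then have "card {h, w} \<le> card (T \<inter> set D)"
      using S D hw f unfolding T_def by (intro card_separated_cycle[where f = f]) auto
    moreover have "card S + card (T \<inter> set D) \<le> length D"
      using D S by (intro card_disjoint_le_length) auto
    ultimately show False using short[OF D(1)] S hw by simp
  next
    case False
    then obtain D where D: "cyc D" "V - T \<subseteq> set D"
      using k_cyclable_cycle[OF kc k(2), of "V - T"] by (metis Diff_subset linear)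
    have cP: "card (insert h P) = card N + 1" using hP finP P(2) by simp
    have "card (insert h P) \<le> card (T \<inter> set D)"
    proof (rule card_separated_cycle[where f = f])
      show "insert h P \<inter> T = {}" using PVT by auto
      show "insert h P \<subseteq> set D" using PVT D by blast
      show "2 \<le> card (insert h P)" using cP m k(2) by simp
    qed (use f P D in \<open>auto simp: T_def\<close>)
    moreover have "card (V - T) + card (T \<inter> set D) \<le> length D"
      using D by (intro card_disjoint_le_length) auto
    \<comment> \<open>With \<open>n = card V\<close> the length is at least
      \<open>3 * n - 3 * k + 2\<close>, and \<open>4 * (k + 1) \<le> 3 * n\<close> makes this at
      least \<open>k + 6\<close>.\<close>
    ultimately show False using short[OF D(1)] cVT cP m L n \<open>length c \<le> card V\<close> by simp
  qed
qed

section \<open>Bounds on attachment and independent sets\<close>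

lemma card_attach_ge_2:
  assumes kc: "k_cyclable k V E" and k: "2 \<le> k" "k \<le> card V" and c: "longest_cyc c" and h: "h \<in> V - set c"
  shows "2 \<le> card (attach c h)"
proof -
  obtain x where x: "x \<in> set c - attach c h" using attach_proper[OF c h] .
  have "{h, x} \<subseteq> V" using h x cyc_simps(3)[OF longest_cycD(1)[OF c]] by auto
  moreover have "card {h, x} \<le> k" using k by (simp add: card_insert_if)
  ultimately obtain D where "cyc D" "{h, x} \<subseteq> set D" using k_cyclable_cycle[OF kc k(2)] by metis
  then have "2 \<le> card (attach c h \<inter> set D)" using card_attach_cycle[OF c h x] by auto
  also have "\<dots> \<le> card (attach c h)" by (intro card_mono) (auto simp: attach_def)
  finally show ?thesis .
qed

text \<open>From \<open>k - 1\<close> attachment vertices on, \<open>h\<close> and their successors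
  contain \<open>k\<close> separated vertices, and a cycle through these has length at least
  \<open>2 * k\<close>.\<close>

lemma card_attach_le:
  assumes kc: "k_cyclable k V E" and k: "2 \<le> k" "k \<le> card V" and c: "longest_cyc c" and h: "h \<in> V - set c"
    and L: "length c < 2 * k"
  shows "card (attach c h) + 2 \<le> k"
proof (rule ccontr)
  assume neg: "\<not> ?thesis"
  obtain P and f :: "'a \<Rightarrow> 'a" where P: "P \<subseteq> set c - attach c h" "card P = card (attach c h)" "inj_on f (insert h P)"
    and f: "\<And>u v. u \<notin> set c - P \<Longrightarrow> v \<notin> set c - P \<Longrightarrow> adj u v \<Longrightarrow> f u = f v"
    using attachment_successors_separated[OF c h] by metis
  have "finite P" "h \<notin> P" using P(1) h finite_subset by auto
  then have "k \<le> card (insert h P)" using neg P by simp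
  then obtain S where S: "S \<subseteq> insert h P" "card S = k" "finite S" using obtain_subset_with_card_n by metis
  have "S \<subseteq> V" using S P h cyc_simps(3)[OF longest_cycD(1)[OF c]] by blast
  then obtain D where D: "cyc D" "S \<subseteq> set D" using k_cyclable_cycle[OF kc k(2)] S by (metis order_refl)
  have dis: "S \<inter> (set c - P) = {}" using S h by auto
  have "card S \<le> card ((set c - P) \<inter> set D)"
    using S D k dis f inj_on_subset[OF P(3) S(1)] by (intro card_separated_cycle[where f = f]) auto
  moreover have "card S + card ((set c - P) \<inter> set D) \<le> length D"
    using D dis by (intro card_disjoint_le_length) auto
  ultimately show False using longest_cycD(2)[OF c D(1)] L S by simp
qed

text \<open>A cycle through \<open>k\<close> independent vertices uses at least as many others; each
  vertex serves as its own label.\<close>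

lemma card_indep_less:
  assumes kc: "k_cyclable k V E" and k: "2 \<le> k" "k \<le> card V" and short: "\<And>D. cyc D \<Longrightarrow> length D < 2 * k"
    and J: "J \<subseteq> V" "indep J"
  shows "card J < k"
proof (rule ccontr)
  assume "\<not> ?thesis"
  then have "k \<le> card J" by simp
  then obtain S where S: "S \<subseteq> J" "card S = k" "finite S" using obtain_subset_with_card_n by metis
  have SV: "S \<subseteq> V" using S J by auto
  obtain D where D: "cyc D" "S \<subseteq> set D" using k_cyclable_cycle[OF kc k(2) SV] S by (metis order_refl)
  have "card S \<le> card ((V - S) \<inter> set D)"
  proof (rule card_separated_cycle[where f = "\<lambda>v. v"])
    show "u = v" if "u \<notin> V - S" "v \<notin> V - S" "adj u v" for u v
      using that adj_V[OF that(3)] S(1) J(2) unfolding indep_def by blast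
  qed (use S D k in auto)
  moreover have "card S + card ((V - S) \<inter> set D) \<le> length D"
    using D by (intro card_disjoint_le_length) auto
  ultimately show False using short[OF D(1)] S by simp
qed

section \<open>Disjoint connections and ears\<close>

text \<open>Take the first vertex in \<open>A\<close> and, before it, the last one in
  \<open>K\<close>.\<close>

lemma trim_path:
  assumes "xs \<noteq> []" "hd xs \<in> K" "set xs \<inter> A \<noteq> {}" "K \<inter> A = {}"
  obtains pre post u M a where "xs = pre @ (u # M @ [a]) @ post" "u \<in> K" "a \<in> A" "set M \<inter> (K \<union> A) = {}"
proof -
  obtain ys a zs where ys: "xs = ys @ a # zs" "a \<in> A" "\<forall>y\<in>set ys. y \<notin> A"
    using split_list_first_prop[of xs "\<lambda>x. x \<in> A"] assms(3) by blast
  have "ys \<noteq> []" using ys assms by auto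
  then have "hd ys \<in> K" "hd ys \<in> set ys" using ys assms(2) by auto
  then obtain pre u M where M: "ys = pre @ u # M" "u \<in> K" "\<forall>y\<in>set M. y \<notin> K"
    using split_list_last_prop[of ys "\<lambda>x. x \<in> K"] by blast
  show ?thesis by (rule that[of pre u M a zs]) (use M ys in auto)
qed

text \<open>Both connections come from the arc \<open>zs\<close>: backwards from \<open>h\<close> to
  the last vertex of \<open>A\<close> on it, and forwards from \<open>h'\<close> along the part
  before that vertex, which still meets \<open>A\<close>.\<close>

lemma two_disjoint_ears_aux:
  assumes D: "cyc (h # ys @ h' # zs)" and A: "2 \<le> card (A \<inter> set (h # ys @ h' # zs))"
    and hA: "h \<notin> A" "h' \<notin> A" and ysA: "set ys \<inter> A = {}"
  obtains l l' where "l \<noteq> []" "l' \<noteq> []" "hd l = h" "hd l' = h'" "set l \<inter> A \<noteq> {}" "set l' \<inter> A \<noteq> {}"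
    "distinct (l @ l')" "successively adj l" "successively adj l'"
proof -
  have Azs: "A \<inter> set (h # ys @ h' # zs) = A \<inter> set zs" using hA ysA by auto
  then have "A \<inter> set zs \<noteq> {}" using A by auto
  then obtain u a v where v: "zs = u @ a # v" "a \<in> A" "\<forall>y\<in>set v. y \<notin> A"
    using split_list_last_prop[of zs "\<lambda>x. x \<in> A"] by blast
  have uA: "set u \<inter> A \<noteq> {}"
  proof
    assume "set u \<inter> A = {}"
    then have "A \<inter> set zs = {a}" using v by auto
    then show False using A Azs by simp
  qed
  have c: "cyc (a # v @ h # ys @ h' # u)"
    using cyc_rotate[of "h # ys @ h' # u" "a # v"] D v by simp
  note s = cyc_simps(2,4)[OF c]
  have "successively adj ((a # v @ [h]) @ ys @ h' # u)" using s(2) by simp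
  then have "successively adj (a # v @ [h])" by (simp only: successively_append_iff)
  then have "successively adj (rev (a # v @ [h]))" by (simp only: successively_rev_adj)
  then have "successively adj (h # rev v @ [a])" by simp
  moreover have "successively adj (h' # u)"
  proof -
    have "successively adj ((a # v @ h # ys) @ h' # u)" using s(2) by simp
    then show ?thesis by (simp only: successively_append_iff)
  qed
  ultimately show ?thesis
    by (intro that[of "h # rev v @ [a]" "h' # u"]) (use s v uA in auto)
qed

text \<open>\<open>h\<close> and \<open>h'\<close> cut the cycle into two arcs. If both meet
  \<open>A\<close>, they are the connections; otherwise all vertices of \<open>A\<close> on the
  cycle lie on one arc.\<close>

lemma two_disjoint_ears:
  assumes D: "cyc D" and K: "h \<in> K" "h' \<in> K" "h \<noteq> h'" "h \<in> set D" "h' \<in> set D"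
    and A: "2 \<le> card (A \<inter> set D)" and KA: "K \<inter> A = {}"
  obtains l l' where "l \<noteq> []" "l' \<noteq> []" "hd l \<in> K" "hd l' \<in> K" "set l \<inter> A \<noteq> {}" "set l' \<inter> A \<noteq> {}"
    "distinct (l @ l')" "successively adj l" "successively adj l'"
proof -
  obtain xs where xs: "cyc (h # xs)" "set (h # xs) = set D" using cyc_from[OF D K(4)] by metis
  then have "h' \<in> set xs" using K by auto
  then obtain ys zs where "xs = ys @ h' # zs" by (meson split_list)
  then have c: "cyc (h # ys @ h' # zs)" "set (h # ys @ h' # zs) = set D" using xs by auto
  have hA: "h \<notin> A" "h' \<notin> A" using K KA by auto
  consider "set ys \<inter> A = {}" | "set zs \<inter> A = {}" | "set ys \<inter> A \<noteq> {}" "set zs \<inter> A \<noteq> {}" by blast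
  then show ?thesis
  proof cases
    case 1
    have A2: "2 \<le> card (A \<inter> set (h # ys @ h' # zs))" using A by (simp only: c(2))
    show ?thesis using two_disjoint_ears_aux[OF c(1) A2 hA 1] that K by metis
  next
    case 2
    have c': "cyc (h' # zs @ h # ys)" using cyc_rotate[of "h # ys" "h' # zs"] c by simp
    have "set (h' # zs @ h # ys) = set D" using c(2) by auto
    then have A2: "2 \<le> card (A \<inter> set (h' # zs @ h # ys))" using A by (simp only:)
    show ?thesis using two_disjoint_ears_aux[OF c' A2 hA(2,1) 2] that K by metis
  next
    case 3
    note s = cyc_simps(2,4)[OF c(1)]
    have "successively adj ((h # ys) @ h' # zs)" using s(2) by simp
    then have "successively adj (h # ys)" "successively adj (h' # zs)"
      by (simp_all only: successively_append_iff)
    then show ?thesis using s(1) 3 K by (intro that[of "h # ys" "h' # zs"]) auto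
  qed
qed

text \<open>Two disjoint connections from \<open>K\<close> to \<open>c\<close>, joined inside
  \<open>K\<close> by a path on at least \<open>d + 1\<close> vertices, form an ear to which
  \<open>ear_bound\<close> applies.\<close>

lemma ear_through_dense_subset:
  assumes c: "longest_cyc c" and K: "K \<subseteq> V - set c" "nocut K"
    and deg: "\<And>v. v \<in> K \<Longrightarrow> d \<le> card (nbrs K v)"
    and D: "cyc D" "h \<in> K" "h' \<in> K" "h \<noteq> h'" "h \<in> set D" "h' \<in> set D" "2 \<le> card (set c \<inter> set D)"
  shows "2 * (d + 2) \<le> length c"
proof -
  have KA: "K \<inter> set c = {}" using K by auto
  have finK: "finite K" using K finite_V by (meson finite_Diff finite_subset)
  obtain l l' where l: "l \<noteq> []" "l' \<noteq> []" "hd l \<in> K" "hd l' \<in> K" "set l \<inter> set c \<noteq> {}" "set l' \<inter> set c \<noteq> {}"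
    "distinct (l @ l')" "successively adj l" "successively adj l'"
    using two_disjoint_ears[OF D KA] by metis
  obtain p1 q1 u M a where M: "l = p1 @ (u # M @ [a]) @ q1" "u \<in> K" "a \<in> set c" "set M \<inter> (K \<union> set c) = {}"
    using trim_path[OF l(1,3,5) KA] by metis
  obtain p2 q2 u' M' a' where M': "l' = p2 @ (u' # M' @ [a']) @ q2" "u' \<in> K" "a' \<in> set c" "set M' \<inter> (K \<union> set c) = {}"
    using trim_path[OF l(2,4,6) KA] by metis
  have dis: "distinct ((u # M @ [a]) @ (u' # M' @ [a']))" using l(7) M(1) M'(1) by auto
  have s: "successively adj (u # M @ [a])" "successively adj (u' # M' @ [a'])"
    using l(8,9) unfolding M(1) M'(1) by (simp_all only: successively_append_iff)
  have "u \<noteq> u'" "a \<noteq> a'" using dis by auto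
  obtain p where p: "path_in K p" "hd p = u" "last p = u'" "d + 1 \<le> length p"
    using nocut_path[OF finK K(2) M(2) M'(2) \<open>u \<noteq> u'\<close>] deg by blast
  have MV: "set M \<subseteq> V"
  proof
    fix x assume "x \<in> set M"
    then obtain r t where "M = r @ x # t" by (meson split_list)
    then have "adj x (hd (t @ [a]))" using s(1) by (auto simp: successively_append_iff successively_Cons)
    then show "x \<in> V" using adj_V by blast
  qed
  have MV': "set M' \<subseteq> V"
  proof
    fix x assume "x \<in> set M'"
    then obtain r t where "M' = r @ x # t" by (meson split_list)
    then have "adj x (hd (t @ [a']))" using s(2) by (auto simp: successively_append_iff successively_Cons)
    then show "x \<in> V" using adj_V by blast
  qed
  have srev: "successively adj (a # rev M @ [u])"
  proof -
    have "successively adj (rev (u # M @ [a]))" using s(1) by (simp only: successively_rev_adj)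
    then show ?thesis by simp
  qed
  define Q where "Q = rev M @ p @ M'"
  have succ: "successively adj (a # Q @ [a'])"
  proof -
    have "successively adj ((a # rev M) @ [u])" using srev by simp
    then have "successively adj ((a # rev M) @ p)"
      using p(1,2) by (simp only: path_in_def successively_append_iff list.sel list.distinct simp_thms)
    moreover have "successively adj (p @ (M' @ [a']))"
      using s(2) p by (auto simp: path_in_def successively_append_iff successively_Cons)
    moreover have "p \<noteq> []" using p by (simp add: path_in_def)
    ultimately show ?thesis unfolding Q_def
      by (auto simp: successively_append_iff successively_Cons hd_append)
  qed
  have "path_in (V - set c) Q"
    using p dis M M' MV MV' K succ unfolding path_in_def Q_def
    by (auto simp: successively_append_iff successively_Cons simp del: successively_rev)
  moreover have "adj a (hd Q)" "adj (last Q) a'"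
  proof -
    have "Q \<noteq> []" using p by (simp add: Q_def path_in_def)
    then show "adj a (hd Q)" "adj (last Q) a'"
      using succ by (simp_all add: successively_append_iff successively_Cons hd_append)
  qed
  ultimately have "2 * length Q + 2 \<le> length c"
    using ear_bound[OF c M(3) M'(3) \<open>a \<noteq> a'\<close>] by blast
  then show ?thesis using p(4) by (simp add: Q_def)
qed

section \<open>The lower bound 2k\<close>

lemma circumference_ge_twice_k:
  assumes kc: "k_cyclable k V E" and k: "2 \<le> k" "k \<le> card V"
    and n: "k * k \<le> card V + 3" "card V \<noteq> 3"
  shows "2 * k \<le> circumference V E"
proof (rule ccontr)
  assume neg: "\<not> ?thesis"
  have short: "length D < 2 * k" if "cyc D" for D
    using circumference_ge[OF that] neg by simp
  obtain c0 where "cyc c0" using k_cyclable_cycle[OF kc k(2), of "{}"] by auto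
  then obtain c where c: "longest_cyc c" using longest_cyc_exists by metis
  note cc = longest_cycD(1)[OF c]
  have L: "length c < 2 * k" using short[OF cc] .
  have setc: "set c \<subseteq> V" "card (set c) = length c" using cyc_simps[OF cc] by auto
  have n4: "4 \<le> card V" using cyc_simps(6)[OF cc] cyc_length_le[OF cc] n by simp
  define R where "R = V - set c"
  have cR: "card R = card V - length c" using setc unfolding R_def by (simp add: card_Diff_subset)
  consider "k = 2" | "k = 3" | "4 \<le> k" using k by linarith
  then show False
  proof cases
    case 1
    then show False using circumference_ge_k_plus_two[OF kc k] n4 neg by simp
  next
    case 2
    then have "0 < card R" using n L cR by simp
    then obtain h where h: "h \<in> V - set c" unfolding R_def by (metis card_gt_0_iff ex_in_conv)
    show False using card_attach_ge_2[OF kc k c h] card_attach_le[OF kc k c h L] 2 by simp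
  next
    case 3
    define d where "d = k - 2"
    have kd: "k = d + 2" "2 \<le> d" using 3 by (auto simp: d_def)
    have nd: "d * d + 4 * d + 1 \<le> card V" using n(1) kd by (simp add: algebra_simps)
    have finR: "finite R" using finite_V by (simp add: R_def)
    obtain J where J: "J \<subseteq> R" "indep J" "card J = alpha R" using alpha_obtain[OF finR] .
    have JV: "J \<subseteq> V" using J by (auto simp: R_def)
    have finJ: "finite J" using J finR finite_subset by auto
    have aR: "alpha R \<le> d + 1" using card_indep_less[OF kc k short JV J(2)] J(3) kd by simp
    \<comment> \<open>As \<open>length c \<le> 2 * d + 3\<close>, at least
      \<open>d * d + 2 * d - 2\<close> vertices lie off \<open>c\<close>, which is enough when
      \<open>alpha R \<le> d\<close>.\<close>
    have R_dense: "d * alpha R + 1 \<le> card R"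
    proof (cases "alpha R = d + 1")
      case False
      then have "d * alpha R \<le> d * d" using aR by simp
      then show ?thesis using nd cR L kd by linarith
    next
      case True
      \<comment> \<open>\<open>J\<close> has \<open>k - 1\<close> elements and no \<open>k\<close>
        vertices are independent, so every vertex of \<open>c\<close> has a neighbour in
        \<open>J\<close>.\<close>
      have "set c \<subseteq> (\<Union>j\<in>J. attach c j)"
      proof
        fix w assume w: "w \<in> set c"
        have "\<exists>j\<in>J. adj j w"
        proof (rule ccontr)
          assume "\<not> ?thesis"
          then have "indep (insert w J)"
            using J(2) adj_sym adj_irrefl by (auto simp: indep_def)
          moreover have "insert w J \<subseteq> V" using w JV setc by auto
          ultimately have "card (insert w J) < k" using card_indep_less[OF kc k short] by blast
          moreover have "w \<notin> J" using w J by (auto simp: R_def)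
          ultimately show False using finJ J(3) True kd by simp
        qed
        then show "w \<in> (\<Union>j\<in>J. attach c j)" using w reach_refl by (auto simp: attach_def)
      qed
      moreover have "finite (\<Union>j\<in>J. attach c j)" using finJ by (simp add: attach_def)
      ultimately have "length c \<le> card (\<Union>j\<in>J. attach c j)"
        unfolding setc(2)[symmetric] by (intro card_mono)
      also have "\<dots> \<le> (\<Sum>j\<in>J. card (attach c j))" by (rule card_UN_le[OF finJ])
      also have "\<dots> \<le> (\<Sum>j\<in>J. d)"
      proof (rule sum_mono)
        fix j assume "j \<in> J"
        then have "j \<in> V - set c" using J(1) by (auto simp: R_def)
        from card_attach_le[OF kc k c this L] show "card (attach c j) \<le> d" using kd by simp
      qed
      also have "\<dots> = (d + 1) * d" using J(3) True by simp
      finally have "length c \<le> (d + 1) * d" .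
      \<comment> \<open>\<open>3 * d\<close> equals \<open>(d + 1) * d\<close> for
        \<open>d = 2\<close> and is at least \<open>2 * d + 3\<close> for larger
        \<open>d\<close>.\<close>
      then have "length c \<le> 3 * d" using L kd by (cases "d = 2") auto
      then show ?thesis using True nd cR by simp
    qed
    obtain K where K: "K \<subseteq> R" "nocut K" "d < card K" "\<And>v. v \<in> K \<Longrightarrow> d \<le> card (nbrs K v)"
      using dense_nocut_subset[OF finR R_dense] kd by auto
    \<comment> \<open>Here \<open>4 \<le> k\<close> matters: two vertices of \<open>K\<close> and
      two of \<open>c\<close> must lie on one cycle.\<close>
    obtain X where X: "X \<subseteq> K" "card X = 2" using obtain_subset_with_card_n[of 2 K] K(3) kd by auto
    then obtain h h' where h: "X = {h, h'}" "h \<noteq> h'" by (meson card_2_iff)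
    have "2 \<le> card (set c)" using setc(2) cyc_simps(6)[OF cc] by linarith
    then obtain Y where Y: "Y \<subseteq> set c" "card Y = 2"
      using obtain_subset_with_card_n by metis
    have "X \<union> Y \<subseteq> V" using X Y K setc by (auto simp: R_def)
    moreover have "card (X \<union> Y) \<le> k" using card_Un_le[of X Y] X Y 3 by simp
    ultimately obtain D where D: "cyc D" "X \<union> Y \<subseteq> set D"
      using k_cyclable_cycle[OF kc k(2)] by metis
    have "Y \<subseteq> set c \<inter> set D" using Y D by auto
    then have "2 \<le> card (set c \<inter> set D)" using Y(2) by (metis card_mono finite_Int List.finite_set)
    then have "2 * (d + 2) \<le> length c"
      using ear_through_dense_subset[OF c K(1)[unfolded R_def] K(2,4) D(1), of h h'] h X D(2) by blast
    then show False using L kd by simp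
  qed
qed

end

subsection \<open>Sharpness: complete bipartite graphs\<close>

definition bip_edges :: "nat \<Rightarrow> nat \<Rightarrow> nat set set" where
  "bip_edges k n = {{a, b} | a b. a < k \<and> k \<le> b \<and> b < n}"

lemma fin_simple_bip: "fin_simple_graph {..<n} (bip_edges k n)"
  by (auto simp: fin_simple_graph_def bip_edges_def)

text \<open>The cycle alternates between \<open>0, 1, ...\<close> and an enumeration of
  \<open>B\<close>.\<close>

lemma bip_cycle:
  assumes "2 \<le> k" and B: "B \<subseteq> {k..<n}" "card B = k"
  obtains c where "is_cycle {..<n} (bip_edges k n) c" "{..<k} \<union> B \<subseteq> set c" "length c = 2 * k"
proof -
  have kn: "k \<le> n" using B assms(1) card_mono[of "{k..<n}" B] by simp
  have "finite B" using B finite_subset by blast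
  then obtain bs where bs: "set bs = B" "distinct bs" using finite_distinct_list by metis
  then have lbs: "length bs = k" using B distinct_card by metis
  have bsB: "k \<le> bs ! j" "bs ! j < n" if "j < k" for j
    using nth_mem[of j bs] that lbs bs(1) B by auto
  define g where "g = (\<lambda>i. if even i then i div 2 else bs ! (i div 2))"
  define c where "c = map g [0..<2 * k]"
  have len: "length c = 2 * k" and nth: "\<And>i. i < 2 * k \<Longrightarrow> c ! i = g i" by (simp_all add: c_def)
  have ev: "g i < k" if "even i" "i < 2 * k" for i using that by (auto simp: g_def)
  have od: "k \<le> g i" "g i < n" if "odd i" "i < 2 * k" for i using that bsB by (auto simp: g_def)
  have "inj_on g {0..<2 * k}"
  proof (rule inj_onI)
    fix i j assume ij: "i \<in> {0..<2 * k}" "j \<in> {0..<2 * k}" "g i = g j"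
    have par: "even i \<longleftrightarrow> even j" using ev[of i] od[of i] ev[of j] od[of j] ij by fastforce
    have "i div 2 < k" "j div 2 < k" using ij by auto
    then have "i div 2 = j div 2"
      using ij(3) par nth_eq_iff_index_eq[OF bs(2), of "i div 2" "j div 2"] lbs
      by (auto simp: g_def split: if_splits)
    then show "i = j" using par by (metis div_mult_mod_eq mod2_eq_if)
  qed
  then have dist: "distinct c" by (simp add: c_def distinct_map)
  have set_c: "set c = g ` {..<2 * k}" by (simp add: c_def atLeast0LessThan)
  have "is_cycle {..<n} (bip_edges k n) c"
    unfolding is_cycle_def
  proof (intro conjI allI impI)
    show "3 \<le> length c" using assms(1) len by simp
    show "set c \<subseteq> {..<n}"
    proof
      fix v assume "v \<in> set c"
      then obtain i where "i < 2 * k" "v = g i" by (auto simp: set_c)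
      then show "v \<in> {..<n}" using ev[of i] od[of i] kn by (cases "even i") auto
    qed
    fix i assume "i < length c"
    then have i: "i < 2 * k" using len by simp
    define j where "j = Suc i mod length c"
    have j: "j < 2 * k" using i len by (simp add: j_def)
    \<comment> \<open>The length is even, so parity also alternates where the cycle closes.\<close>
    have par: "even j \<longleftrightarrow> odd i"
      using len by (simp add: j_def dvd_mod_iff)
    show "{c ! i, c ! (Suc i mod length c)} \<in> bip_edges k n"
    proof (cases "even i")
      case True
      then show ?thesis
        using ev[of i] od[of j] i j par nth unfolding j_def[symmetric] bip_edges_def by auto
    next
      case False
      then show ?thesis
        using ev[of j] od[of i] i j par nth unfolding j_def[symmetric] bip_edges_def
        by (auto simp: insert_commute)
    qed
  qed (rule dist)
  moreover have "{..<k} \<union> B \<subseteq> set c"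
  proof
    fix v assume "v \<in> {..<k} \<union> B"
    then consider "v < k" | j where "j < k" "v = bs ! j"
      using bs(1) lbs by (auto simp: in_set_conv_nth)
    then show "v \<in> set c"
    proof cases
      case 1
      then have "v = g (2 * v)" "2 * v < 2 * k" by (auto simp: g_def)
      then show ?thesis unfolding set_c by blast
    next
      case 2
      then have "v = g (2 * j + 1)" "2 * j + 1 < 2 * k" by (auto simp: g_def)
      then show ?thesis unfolding set_c by blast
    qed
  qed
  ultimately show ?thesis using that len by blast
qed

text \<open>At most \<open>k\<close> of the given vertices lie in the large part; extended to
  exactly \<open>k\<close>, they share a cycle with the whole small part.\<close>

lemma bip_k_cyclable:
  assumes k: "2 \<le> k" and n: "2 * k \<le> n"
  shows "k_cyclable k {..<n} (bip_edges k n)"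
  unfolding k_cyclable_def
proof (intro allI impI)
  fix S :: "nat set" assume S: "S \<subseteq> {..<n} \<and> card S = k"
  then have "finite S" using finite_subset by blast
  then have "card (S \<inter> {k..<n}) \<le> k" using S card_mono[of S "S \<inter> {k..<n}"] by simp
  moreover have "k \<le> card {k..<n}" using n by simp
  ultimately have "\<exists>B. S \<inter> {k..<n} \<subseteq> B \<and> B \<subseteq> {k..<n} \<and> card B = k"
    by (rule exists_subset_between) auto
  then obtain B where B: "S \<inter> {k..<n} \<subseteq> B" "B \<subseteq> {k..<n}" "card B = k" by blast
  obtain c where c: "is_cycle {..<n} (bip_edges k n) c" "{..<k} \<union> B \<subseteq> set c"
    using bip_cycle[OF k B(2,3)] by metis
  have "S \<subseteq> {..<k} \<union> B" using S B(1) by (auto simp: subset_iff not_less)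
  then have "S \<subseteq> set c" using c(2) by (rule order_trans)
  then show "cyclable {..<n} (bip_edges k n) S" using S c(1) by (auto simp: cyclable_def)
qed

text \<open>The large part is independent, so \<open>card_separated_cycle\<close> bounds its share
  of a cycle by that of the small part.\<close>

lemma bip_circumference:
  assumes k: "2 \<le> k" and n: "2 * k \<le> n"
  shows "circumference {..<n} (bip_edges k n) = 2 * k"
proof -
  interpret sgraph "{..<n}" "bip_edges k n" by (unfold_locales) (rule fin_simple_bip)
  have le: "length D \<le> 2 * k" if D: "cyc D" for D
  proof -
    define P where "P = set D - {..<k}"
    have no_adj: "\<not> adj u v" if "u \<notin> {..<k}" "v \<notin> {..<k}" for u v
      using that unfolding adj_def by (auto simp: bip_edges_def doubleton_eq_iff)
    have T: "card ({..<k} \<inter> set D) \<le> k"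
      using card_mono[of "{..<k}" "{..<k} \<inter> set D"] by simp
    have "card P \<le> k"
    proof (cases "2 \<le> card P")
      case True
      have "card P \<le> card ({..<k} \<inter> set D)"
        using no_adj D True by (intro card_separated_cycle[where f = "\<lambda>v. v"]) (auto simp: P_def)
      then show ?thesis using T by simp
    qed (use k in simp)
    moreover have "set D = ({..<k} \<inter> set D) \<union> P" by (auto simp: P_def)
    then have "card (set D) \<le> card ({..<k} \<inter> set D) + card P" by (metis card_Un_le)
    ultimately show ?thesis using T cyc_simps(7)[OF D] by simp
  qed
  have "card {k..<2 * k} = k" "{k..<2 * k} \<subseteq> {k..<n}" using n by auto
  then obtain c where "is_cycle {..<n} (bip_edges k n) c" "length c = 2 * k"
    using bip_cycle[OF k] by metis
  then have "2 * k \<le> circumference {..<n} (bip_edges k n)"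
    using circumference_ge is_cycle_iff_cyc by metis
  then show ?thesis using circumference_le[OF le] by simp
qed

section \<open>Assembling the theorem\<close>

lemma real_le_sqrt_iff: "real k \<le> sqrt (real n + 3) \<longleftrightarrow> k * k \<le> n + 3"
proof -
  have "real k \<le> sqrt (real n + 3) \<longleftrightarrow> (real k)\<^sup>2 \<le> real n + 3"
    using real_sqrt_le_iff[of "(real k)\<^sup>2" "real n + 3"] by simp
  also have "\<dots> \<longleftrightarrow> real (k * k) \<le> real (n + 3)" by (simp add: power2_eq_square)
  finally show ?thesis by (simp only: of_nat_le_iff)
qed

text \<open>The triangle is 2-cyclable and \<open>2 \<le> sqrt 6\<close>, but its circumference is
  3; hence \<open>n = 3\<close> is excluded from (i). Sharpness asks for \<open>4 \<le> n\<close>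
  since a cycle of length \<open>2 * k\<close> has at least four vertices.\<close>

theorem theorem1:
  fixes n k :: nat
  assumes "2 \<le> k" and "k \<le> n"
  shows "(\<forall>(V :: 'a set) E. fin_simple_graph V E \<and> card V = n \<and> k_cyclable k V E \<longrightarrow>
            (n \<noteq> 3 \<and> real k \<le> sqrt (real n + 3) \<longrightarrow> 2 * k \<le> circumference V E) \<and>
            (real k \<le> 3 * real n / 4 - 1 \<longrightarrow> k + 2 \<le> circumference V E)) \<and>
         (4 \<le> n \<and> real k \<le> sqrt (real n + 3) \<longrightarrow>
            (\<exists>(V :: nat set) E. fin_simple_graph V E \<and> card V = n \<and> k_cyclable k V E \<and>
               circumference V E = 2 * k))"
proof (intro conjI allI impI)
  fix V :: "'a set" and E
  assume G: "fin_simple_graph V E \<and> card V = n \<and> k_cyclable k V E"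
  interpret sgraph V E using G by unfold_locales simp
  show "2 * k \<le> circumference V E" if "n \<noteq> 3 \<and> real k \<le> sqrt (real n + 3)"
    using circumference_ge_twice_k[of k] that G assms by (simp add: real_le_sqrt_iff)
  show "k + 2 \<le> circumference V E" if "real k \<le> 3 * real n / 4 - 1"
  proof -
    have "real (4 * (k + 1)) \<le> real (3 * n)" using that by simp
    then have "4 * (k + 1) \<le> 3 * n" by (simp only: of_nat_le_iff)
    then show ?thesis using circumference_ge_k_plus_two[of k] G assms by simp
  qed
next
  assume "4 \<le> n \<and> real k \<le> sqrt (real n + 3)"
  then have n: "4 \<le> n" "k * k \<le> n + 3" by (simp_all add: real_le_sqrt_iff)
  \<comment> \<open>The large part must have at least \<open>k\<close> vertices.\<close>
  have "2 * k \<le> n"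
  proof (cases "k = 2")
    case False
    then have "3 \<le> k" using assms by simp
    then have "3 * k \<le> k * k" by simp
    then show ?thesis using n \<open>3 \<le> k\<close> by linarith
  qed (use n in simp)
  then show "\<exists>(V :: nat set) E. fin_simple_graph V E \<and> card V = n \<and> k_cyclable k V E \<and>
      circumference V E = 2 * k"
    using fin_simple_bip bip_k_cyclable[OF assms(1)] bip_circumference[OF assms(1)]
    by (intro exI[of _ "{..<n}"] exI[of _ "bip_edges k n"]) simp
qed

end
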